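(* For an odd positive integer $m$, let $D_m=\mathbb{Z}[T]/(m,T+1)$ be the dihedral quandle, i.e. $D_m=\mathbb{Z}/m\mathbb{Z}$ with $x*y=2y-x$. Then the third quandle homology $H_3^Q(D_m;\mathbb{Z})$ is isomorphic to $\mathbb{Z}/m\mathbb{Z}$.
   Context: A quandle is a set $X$ with a binary operation $*$ such that $x*x=x$, $(x*y)*z=(x*z)*(y*z)$ for all $x,y,z$, and for all $x,y\in X$ there is a unique $w\in X$ with $w*y=x$. Quandle homology: $C_n^R(X;\mathbb{Z})$ is the free $\mathbb{Z}$-module on $X^n$ with $\partial_n(x_1,\dots,x_n)=\sum_{i=1}^n(-1)^i\bigl((x_1*x_i,\dots,x_{i-1}*x_i,x_{i+1},\dots,x_n)-(x_1,\dots,x_{i-1},x_{i+1},\dots,x_n)\bigr)$; $C_n^D(X;\mathbb{Z})$ is the subcomplex spanned by tuples with $x_i=x_{i+1}$ for some $i\le n-1$ (zero for $n\le1$); $H_n^Q(X;\mathbb{Z})$ is the homology of $C_*^R/C_*^D$. *)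

theory Defs
  imports "HOL-Algebra.Coset" "HOL-Algebra.Free_Abelian_Groups" "HOL-Algebra.Elementary_Groups"
begin

locale quandle =
  fixes X :: "'a set" and op :: "'a \<Rightarrow> 'a \<Rightarrow> 'a"
  assumes closed: "\<lbrakk>x \<in> X; y \<in> X\<rbrakk> \<Longrightarrow> op x y \<in> X"
    and idem: "x \<in> X \<Longrightarrow> op x x = x"
    and self_distrib: "\<lbrakk>x \<in> X; y \<in> X; z \<in> X\<rbrakk> \<Longrightarrow> op (op x y) z = op (op x z) (op y z)"
    and right_invertible: "\<lbrakk>x \<in> X; y \<in> X\<rbrakk> \<Longrightarrow> \<exists>!w. w \<in> X \<and> op w y = x"

(* n-tuples are lists of length n.  In degree 0 there is exactly one tuple, the empty one. *)

definition tuples :: "'a set \<Rightarrow> nat \<Rightarrow> 'a list set" where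
  "tuples X n = {xs. length xs = n \<and> set xs \<subseteq> X}"

definition rack_chain_group :: "'a set \<Rightarrow> nat \<Rightarrow> ('a list \<Rightarrow>\<^sub>0 int) monoid" where
  "rack_chain_group X n = free_Abelian_group (tuples X n)"

(* The index i is 1-based, as in the usual formula: x_i is xs ! (i - 1), and take (i - 1) xs and
   drop i xs are the entries before and after it. *)

definition tuple_boundary :: "('a \<Rightarrow> 'a \<Rightarrow> 'a) \<Rightarrow> 'a list \<Rightarrow> 'a list \<Rightarrow>\<^sub>0 int" where
  "tuple_boundary op xs =
     (\<Sum>i = 1..length xs. frag_cmul ((- 1) ^ i)
        (frag_of (map (\<lambda>x. op x (xs ! (i - 1))) (take (i - 1) xs) @ drop i xs)
         - frag_of (take (i - 1) xs @ drop i xs)))"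

definition rack_boundary ::
    "('a \<Rightarrow> 'a \<Rightarrow> 'a) \<Rightarrow> ('a list \<Rightarrow>\<^sub>0 int) \<Rightarrow> 'a list \<Rightarrow>\<^sub>0 int" where
  "rack_boundary op = frag_extend (tuple_boundary op)"

definition degenerate_tuples :: "'a set \<Rightarrow> nat \<Rightarrow> 'a list set" where
  "degenerate_tuples X n = {xs \<in> tuples X n. \<exists>i. Suc i < n \<and> xs ! i = xs ! Suc i}"

definition degenerate_chains :: "'a set \<Rightarrow> nat \<Rightarrow> ('a list \<Rightarrow>\<^sub>0 int) set" where
  "degenerate_chains X n = generate (rack_chain_group X n) (frag_of ` degenerate_tuples X n)"

definition quandle_chain_group :: "'a set \<Rightarrow> nat \<Rightarrow> ('a list \<Rightarrow>\<^sub>0 int) set monoid" where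
  "quandle_chain_group X n = rack_chain_group X n Mod degenerate_chains X n"

(* The map from degree n to degree n - 1 induced on cosets: every representative c of the coset S
   gives the same coset of its boundary, because the degenerate chains form a subcomplex.
   For n = 0 the boundary is zero, so the truncated n - 1 is harmless. *)

definition quandle_boundary ::
    "'a set \<Rightarrow> ('a \<Rightarrow> 'a \<Rightarrow> 'a) \<Rightarrow> nat \<Rightarrow> ('a list \<Rightarrow>\<^sub>0 int) set \<Rightarrow> ('a list \<Rightarrow>\<^sub>0 int) set" where
  "quandle_boundary X op n S =
     the_elem ((\<lambda>c. degenerate_chains X (n - 1) #>\<^bsub>rack_chain_group X (n - 1)\<^esub> rack_boundary op c) ` S)"

definition quandle_cycles ::
    "'a set \<Rightarrow> ('a \<Rightarrow> 'a \<Rightarrow> 'a) \<Rightarrow> nat \<Rightarrow> ('a list \<Rightarrow>\<^sub>0 int) set set" where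
  "quandle_cycles X op n =
     kernel (quandle_chain_group X n) (quandle_chain_group X (n - 1)) (quandle_boundary X op n)"

definition quandle_boundaries ::
    "'a set \<Rightarrow> ('a \<Rightarrow> 'a \<Rightarrow> 'a) \<Rightarrow> nat \<Rightarrow> ('a list \<Rightarrow>\<^sub>0 int) set set" where
  "quandle_boundaries X op n =
     quandle_boundary X op (Suc n) ` carrier (quandle_chain_group X (Suc n))"

definition quandle_homology ::
    "'a set \<Rightarrow> ('a \<Rightarrow> 'a \<Rightarrow> 'a) \<Rightarrow> nat \<Rightarrow> ('a list \<Rightarrow>\<^sub>0 int) set set monoid" where
  "quandle_homology X op n =
     (quandle_chain_group X n)\<lparr>carrier := quandle_cycles X op n\<rparr> Mod quandle_boundaries X op n"

(* In Z[T]/(m, T + 1) one has T = -1, so x * y = T x + (1 - T) y = 2 y - x in Z/mZ, which is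
   represented by the integers 0, ..., m - 1. *)

definition dihedral_carrier :: "nat \<Rightarrow> int set" where
  "dihedral_carrier m = carrier (integer_mod_group m)"

definition dihedral_op :: "nat \<Rightarrow> int \<Rightarrow> int \<Rightarrow> int" where
  "dihedral_op m x y = (2 * y - x) mod int m"

lemma dihedral_quandle:
  assumes "m > 0"
  shows "quandle (dihedral_carrier m) (dihedral_op m)"
proof
  fix x y z :: int
  assume x: "x \<in> dihedral_carrier m"
  then have xm: "x mod int m = x"
    using assms by (simp add: dihedral_carrier_def carrier_integer_mod_group)
  show "dihedral_op m x x = x"
    using xm by (simp add: dihedral_op_def)
  assume y: "y \<in> dihedral_carrier m"
  show "dihedral_op m x y \<in> dihedral_carrier m"
    using assms by (simp add: dihedral_op_def dihedral_carrier_def carrier_integer_mod_group)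
  show "dihedral_op m (dihedral_op m x y) z
      = dihedral_op m (dihedral_op m x z) (dihedral_op m y z)"
  proof -
    have "(2 * z - (2 * y - x) mod int m) mod int m = (2 * z - (2 * y - x)) mod int m"
      by (rule mod_diff_right_eq)
    also have "2 * z - (2 * y - x) = 2 * (2 * z - y) - (2 * z - x)"
      by simp
    also have "\<dots> mod int m = ((2 * (2 * z - y)) mod int m - (2 * z - x) mod int m) mod int m"
      by (rule mod_diff_eq[symmetric])
    also have "(2 * (2 * z - y)) mod int m = (2 * ((2 * z - y) mod int m)) mod int m"
      by (rule mod_mult_right_eq[symmetric])
    also have "(\<dots> - (2 * z - x) mod int m) mod int m
        = (2 * ((2 * z - y) mod int m) - (2 * z - x) mod int m) mod int m"
      by (rule mod_diff_left_eq)
    finally show ?thesis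
      by (simp only: dihedral_op_def)
  qed
  have inv: "(2 * y - (2 * y - w) mod int m) mod int m = w mod int m" for w
    using mod_diff_right_eq[of "2 * y" "2 * y - w" "int m"] by (simp only: diff_diff_eq2 add_diff_cancel_left')
  show "\<exists>!w. w \<in> dihedral_carrier m \<and> dihedral_op m w y = x"
  proof (rule ex1I[of _ "dihedral_op m x y"])
    show "dihedral_op m x y \<in> dihedral_carrier m \<and> dihedral_op m (dihedral_op m x y) y = x"
    proof
      show "dihedral_op m x y \<in> dihedral_carrier m"
        using assms by (simp add: dihedral_op_def dihedral_carrier_def carrier_integer_mod_group)
      show "dihedral_op m (dihedral_op m x y) y = x"
        using inv[of x] xm by (simp only: dihedral_op_def)
    qed
  next
    fix w
    assume w: "w \<in> dihedral_carrier m \<and> dihedral_op m w y = x"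
    then have wm: "w mod int m = w"
      using assms by (simp add: dihedral_carrier_def carrier_integer_mod_group)
    have "x = (2 * y - w) mod int m"
      using w by (simp only: dihedral_op_def)
    then show "w = dihedral_op m x y"
      using inv[of w] wm by (simp only: dihedral_op_def)
  qed
qed

end

theory Submission
  imports Defs
begin

text \<open>
  Encode a 3-cochain \<open>f\<close> with values in an abelian group by the functions
  \<open>\<psi>\<^sub>z(p, q) = f(p, y, z)\<close>, where \<open>y\<close> is the point with \<open>p * y = q\<close>. A cocycle then becomes a crossed
  homomorphism \<open>z \<mapsto> \<psi>\<^sub>z\<close> on the group generated by the reflections of \<open>D\<^sub>m\<close>, up to functions of the
  form \<open>l(q) - l(p)\<close>; this uses that a function of \<open>(p, q)\<close> with vanishing boundary is of that form,
  i.e. \<open>H\<^sub>2 = 0\<close>. Its value \<open>\<rho>\<close> on a generating translation determines \<open>f\<close> up to coboundaries, and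
  the norm of \<open>\<rho>\<close> has the form \<open>l(q) - l(p)\<close> with \<open>l(p + 1) - l(p) = \<kappa>\<close> constant. Hence \<open>m \<kappa> = 0\<close>, and if \<open>\<kappa> = 0\<close> then \<open>\<rho>\<close> is a
  difference and \<open>f\<close> is a coboundary.

  For the tautological cocycle with values in the 3-chains modulo boundaries, divided further by
  \<open>\<kappa>\<close>, this says that \<open>\<kappa>\<close> generates \<open>H\<^sub>3\<close>, so that \<open>H\<^sub>3\<close> is cyclic of order dividing \<open>m\<close>. A cocycle of
  Mochizuki's type takes the value \<open>-1\<close> on an explicit cycle, so the order is \<open>m\<close>.
\<close>

section \<open>Cocycles with values modulo a subgroup\<close>

text \<open>Quotient groups are avoided by working with congruences modulo \<open>B\<close>, and residues modulo \<open>m\<close> by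
  working with \<open>m\<close>-periodic functions of integers.\<close>

locale dihedral_coefficients =
  fixes m :: nat and B :: "'b::ab_group_add set"
  assumes odd_m: "odd m"
    and B_0: "0 \<in> B"
    and B_diff: "\<And>a b. a \<in> B \<Longrightarrow> b \<in> B \<Longrightarrow> a - b \<in> B"
begin

lemma m_pos: "m > 0"
  using odd_m by (cases m) auto

lemma B_uminus: "a \<in> B \<Longrightarrow> - a \<in> B"
  using B_diff[OF B_0] by simp

lemma B_add: "a \<in> B \<Longrightarrow> b \<in> B \<Longrightarrow> a + b \<in> B"
  using B_diff[of a "- b"] B_uminus[of b] by simp

lemma B_sum: "(\<And>i. i \<in> I \<Longrightarrow> a i \<in> B) \<Longrightarrow> sum a I \<in> B"
  by (induction I rule: infinite_finite_induct) (auto intro: B_0 B_add)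

section \<open>Periodic functions of integers and of pairs, modulo \<open>B\<close>\<close>

definition half :: int where
  "half = (int m + 1) div 2"

lemma two_half: "2 * half = int m + 1"
  using odd_m by (auto simp: half_def elim!: oddE)

lemma two_half_mult: "2 * (half * x) = x + int m * x"
  using two_half by (metis mult.assoc distrib_right mult_1 add.commute)

definition periodic :: "(int \<Rightarrow> int \<Rightarrow> 'b) \<Rightarrow> bool" where
  "periodic w \<longleftrightarrow> (\<forall>p q. w (p mod int m) (q mod int m) = w p q)"

lemma periodicD:
  assumes "periodic w" "p mod int m = p' mod int m" "q mod int m = q' mod int m"
  shows "w p q = w p' q'"
  using assms unfolding periodic_def by metis

text \<open>The multiples of \<open>d\<close> meet every residue class because \<open>d\<close> is a
  unit modulo \<open>m\<close>. The cases needed are \<open>d\<close> = 1, -1 and 2; the last one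
  rests on \<open>m\<close> being odd.\<close>

lemma step_const:
  assumes per: "\<And>x. F (x mod int m) = F x"
    and step: "\<And>x. F (x + d) - F x \<in> B"
    and inverse: "(d * d') mod int m = 1 mod int m"
  shows "F x - F y \<in> B"
proof -
  have iter: "F (y + int k * d) - F y \<in> B" for k
  proof (induction k)
    case 0
    then show ?case by (simp add: B_0)
  next
    case (Suc k)
    have "F (y + int (Suc k) * d) - F y
        = (F ((y + int k * d) + d) - F (y + int k * d)) + (F (y + int k * d) - F y)"
      by (simp add: algebra_simps)
    also have "\<dots> \<in> B" by (intro B_add step Suc)
    finally show ?case .
  qed
  define k where "k = nat ((d' * (x - y)) mod int m)"
  have k: "int k = (d' * (x - y)) mod int m"
    using m_pos by (simp add: k_def)
  have "(y + int k * d) mod int m = (y + (d' * (x - y)) * d) mod int m"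
    unfolding k by (intro mod_add_cong mod_mult_cong) simp_all
  also have "(d' * (x - y)) * d = (d * d') * (x - y)"
    by simp
  also have "(y + (d * d') * (x - y)) mod int m = (y + ((d * d') mod int m) * (x - y)) mod int m"
    by (intro mod_add_cong mod_mult_cong) simp_all
  also have "\<dots> = (y + 1 * (x - y)) mod int m"
    unfolding inverse by (intro mod_add_cong mod_mult_cong) simp_all
  also have "\<dots> = x mod int m" by simp
  finally have "F (y + int k * d) = F x"
    using per by metis
  then show ?thesis using iter[of k] by simp
qed

text \<open>Equivalent to \<open>w p q\<close> being congruent to \<open>l q - l p\<close> for some
  \<open>l\<close>: take \<open>l = w 0\<close>. The additive form avoids choosing a
  potential.\<close>

definition triv :: "(int \<Rightarrow> int \<Rightarrow> 'b) \<Rightarrow> bool" where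
  "triv w \<longleftrightarrow> (\<forall>p q r. w p q + w q r - w p r \<in> B)"

lemma trivD: "triv w \<Longrightarrow> w p q + w q r - w p r \<in> B"
  unfolding triv_def by simp

lemma triv_cong: "triv w \<Longrightarrow> (\<And>p q. w' p q = w p q) \<Longrightarrow> triv w'"
  unfolding triv_def by simp

lemma triv_diff: "triv v \<Longrightarrow> triv w \<Longrightarrow> triv (\<lambda>p q. v p q - w p q)"
  unfolding triv_def
proof (intro allI)
  fix p q r
  assume "\<forall>p q r. v p q + v q r - v p r \<in> B" "\<forall>p q r. w p q + w q r - w p r \<in> B"
  then have "(v p q + v q r - v p r) - (w p q + w q r - w p r) \<in> B"
    using B_diff by blast
  then show "v p q - w p q + (v q r - w q r) - (v p r - w p r) \<in> B"
    by (simp add: algebra_simps)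
qed

lemma triv_0: "triv (\<lambda>p q. 0)"
  by (simp add: triv_def B_0)

lemma triv_add: "triv v \<Longrightarrow> triv w \<Longrightarrow> triv (\<lambda>p q. v p q + w p q)"
  using triv_diff[OF _ triv_diff[OF triv_0], of v w] by simp

lemma triv_sum: "(\<And>i. i \<in> I \<Longrightarrow> triv (w i)) \<Longrightarrow> triv (\<lambda>p q. \<Sum>i\<in>I. w i p q)"
  by (induction I rule: infinite_finite_induct) (auto simp: triv_0 intro: triv_add)

lemma triv_shift: "triv w \<Longrightarrow> triv (\<lambda>p q. w (p + c) (q + c))"
  unfolding triv_def by blast

lemma triv_reflect: "triv w \<Longrightarrow> triv (\<lambda>p q. w (c - p) (c - q))"
  unfolding triv_def by blast

lemma triv_potential: "(\<And>p q. w p q - (l q - l p) \<in> B) \<Longrightarrow> triv w"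
  unfolding triv_def
proof (intro allI)
  fix p q r
  assume *: "\<And>p q. w p q - (l q - l p) \<in> B"
  have "w p q + w q r - w p r
      = (w p q - (l q - l p)) + (w q r - (l r - l q)) - (w p r - (l r - l p))"
    by (simp add: algebra_simps)
  also have "\<dots> \<in> B" by (intro B_add B_diff *)
  finally show "w p q + w q r - w p r \<in> B" .
qed

text \<open>The coboundary of \<open>g\<close> at the triple \<open>(p, y, z)\<close> with \<open>p * y = q\<close>, where \<open>g p q\<close> is the value on the
  pair \<open>(p, y)\<close>.\<close>

definition cob :: "(int \<Rightarrow> int \<Rightarrow> 'b) \<Rightarrow> int \<Rightarrow> int \<Rightarrow> int \<Rightarrow> 'b" where
  "cob g z p q = g p q + g q (2 * z - q) - g p (2 * z - p) - g (2 * z - p) (2 * z - q)"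

definition cochain :: "(int \<Rightarrow> int \<Rightarrow> 'b) \<Rightarrow> bool" where
  "cochain g \<longleftrightarrow> periodic g \<and> (\<forall>p. g p p \<in> B)"

text \<open>Closedness says that in a path \<open>p\<close>, \<open>q\<close>, \<open>r\<close> the
  middle point may be moved by \<open>r - p\<close> without changing \<open>w p q + w q r\<close>.
  If \<open>r\<close> is a neighbour of \<open>p\<close>, the middle point is therefore arbitrary.
  This makes \<open>w\<close> antisymmetric, and then additive one unit step at a time.\<close>

lemma closed_imp_triv:
  assumes w: "cochain w" and closed: "\<And>y p q. cob w y p q \<in> B"
  shows "triv w"
proof -
  have per: "periodic w" and diag: "\<And>p. w p p \<in> B"
    using w by (auto simp: cochain_def)
  have square: "w p q + w q r - w p (q + r - p) - w (q + r - p) r \<in> B" for p q r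
  proof -
    \<comment> \<open>The point with \<open>q * y = r\<close>; it also satisfies
      \<open>p * y = q + r - p\<close>.\<close>
    define y where "y = half * (q + r)"
    have y: "2 * y = q + r + int m * (q + r)"
      unfolding y_def by (rule two_half_mult)
    have "w q (2 * y - q) = w q r" "w p (2 * y - p) = w p (q + r - p)"
      "w (2 * y - p) (2 * y - q) = w (q + r - p) r"
      unfolding y by (rule periodicD[OF per]; simp add: mod_eq_dvd_iff)+
    then show ?thesis using closed[where y = y and p = p and q = q] unfolding cob_def by simp
  qed
  have one_step: "w p q + w q (p + e) - w p (p + e) \<in> B" if "e * e = 1" for p q e
  proof -
    have "(\<lambda>q. w p q + w q (p + e)) q - (\<lambda>q. w p q + w q (p + e)) p \<in> B"
    proof (rule step_const[where d = e and d' = e])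
      show "w p (x mod int m) + w (x mod int m) (p + e) = w p x + w x (p + e)" for x
        using periodicD[OF per, of p p "x mod int m" x]
          periodicD[OF per, of "x mod int m" x "p + e" "p + e"] by simp
      show "w p (x + e) + w (x + e) (p + e) - (w p x + w x (p + e)) \<in> B" for x
        using B_uminus[OF square[where p = p and q = x and r = "p + e"]] by (simp add: algebra_simps)
    qed (simp add: that)
    from B_add[OF this diag[of p]] show ?thesis by (simp add: algebra_simps)
  qed
  have up: "w p q + w q (p + 1) - w p (p + 1) \<in> B" for p q
    using one_step[of 1] by simp
  have down: "w (p + 1) q + w q p - w (p + 1) p \<in> B" for p q
    using one_step[of "-1" "p + 1"] by simp
  \<comment> \<open>The defect of antisymmetry. Comparing \<open>sum_S\<close> at \<open>p\<close>
    and \<open>p + 1\<close> shows that \<open>S\<close> is unchanged by a step of 2 in its first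
    argument, so it reduces to the diagonal, where it vanishes.\<close>
  define S where "S p q = w p q + w q p" for p q
  have diagonal: "S (p + 1) (q + 1) - S p q \<in> B" for p q
  proof -
    have "S (p + 1) (q + 1) - S p q
        = (w p (q + 1) + w (q + 1) (p + 1) - w p (p + 1))
        + (w q (p + 1) + w (p + 1) (q + 1) - w q (q + 1))
        - (w p q + w q (p + 1) - w p (p + 1)) - (w q p + w p (q + 1) - w q (q + 1))"
      by (simp add: S_def algebra_simps)
    also have "\<dots> \<in> B" by (intro B_add B_diff up)
    finally show ?thesis .
  qed
  have sum_S: "S p q + S (p + 1) q - S p (p + 1) \<in> B" for p q
    using B_add[OF up[of p q] down[of p q]] by (simp add: S_def algebra_simps)
  have S_0: "S p q \<in> B" for p q
  proof -
    have "S p q - S q q \<in> B"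
    proof (rule step_const[where d = 2 and d' = half])
      show "S (x mod int m) q = S x q" for x
        using periodicD[OF per, of "x mod int m" x q q] periodicD[OF per, of q q "x mod int m" x]
        by (simp add: S_def)
      show "S (x + 2) q - S x q \<in> B" for x
      proof -
        have "S (x + 2) q - S x q = (S (x + 1) q + S (x + 1 + 1) q - S (x + 1) (x + 1 + 1))
            - (S x q + S (x + 1) q - S x (x + 1)) + (S (x + 1) (x + 1 + 1) - S x (x + 1))"
          by (simp add: algebra_simps)
        also have "\<dots> \<in> B" by (intro B_add B_diff sum_S diagonal)
        finally show ?thesis .
      qed
    qed (simp add: two_half)
    moreover have "S q q \<in> B" by (simp add: S_def B_add diag)
    ultimately show ?thesis using B_add by fastforce
  qed
  have step: "w p (q + 1) - w p q - w q (q + 1) \<in> B" for p q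
    using B_diff[OF up[of q p] S_0[of p q]] by (simp add: S_def algebra_simps)
  have "w p q + w q (q + int k) - w p (q + int k) \<in> B" for p q k
  proof (induction k)
    case 0
    then show ?case by (simp add: diag)
  next
    case (Suc k)
    have "w p q + w q (q + int (Suc k)) - w p (q + int (Suc k))
        = (w p q + w q (q + int k) - w p (q + int k))
        + (w q (q + int k + 1) - w q (q + int k) - w (q + int k) (q + int k + 1))
        - (w p (q + int k + 1) - w p (q + int k) - w (q + int k) (q + int k + 1))"
      by (simp add: algebra_simps)
    also have "\<dots> \<in> B" by (intro B_add B_diff step Suc)
    finally show ?case .
  qed
  moreover have "w p r = w p (q + int (nat ((r - q) mod int m)))" for p q r
    using m_pos by (intro periodicD[OF per]) (simp_all add: mod_simps)
  ultimately show ?thesis unfolding triv_def by metis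
qed

text \<open>For \<open>q = p * x\<close>, \<open>\<psi> z p q\<close> is the value of a 3-cochain on
  \<open>(p, x, z)\<close>. The conditions are periodicity, vanishing modulo \<open>B\<close> on
  degenerate triples with \<open>p = x\<close> and with \<open>x = z\<close>, and vanishing, up to
  sign, on the boundary of \<open>(p, x, y, z)\<close>.\<close>

definition cocycle :: "(int \<Rightarrow> int \<Rightarrow> int \<Rightarrow> 'b) \<Rightarrow> bool" where
  "cocycle \<psi> \<longleftrightarrow>
     (\<forall>z p q. \<psi> (z mod int m) (p mod int m) (q mod int m) = \<psi> z p q) \<and>
     (\<forall>z p. \<psi> z p p \<in> B) \<and>
     (\<forall>z p. \<psi> z p (2 * z - p) \<in> B) \<and>
     (\<forall>z y p q. \<psi> y p q - \<psi> (2 * z - y) (2 * z - p) (2 * z - q) - cob (\<psi> z) y p q \<in> B)"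

lemma cocycle_periodic:
  assumes "cocycle \<psi>" "z mod int m = z' mod int m" "p mod int m = p' mod int m"
    "q mod int m = q' mod int m"
  shows "\<psi> z p q = \<psi> z' p' q'"
  using assms unfolding cocycle_def by metis

lemma
  assumes "cocycle \<psi>"
  shows cocycle_diag: "\<psi> z p p \<in> B"
    and cocycle_diag': "\<psi> z p (2 * z - p) \<in> B"
    and cocycleD: "\<psi> y p q - \<psi> (2 * z - y) (2 * z - p) (2 * z - q) - cob (\<psi> z) y p q \<in> B"
  using assms unfolding cocycle_def by auto

lemma cocycle_cochain: "cocycle \<psi> \<Longrightarrow> cochain (\<psi> z)"
  unfolding cochain_def periodic_def
  by (auto intro: cocycle_periodic cocycle_diag)

section \<open>Coboundaries, and cocycles as crossed homomorphisms\<close>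

lemma cob_periodic:
  assumes "periodic g" "z mod int m = z' mod int m" "p mod int m = p' mod int m"
    "q mod int m = q' mod int m"
  shows "cob g z p q = cob g z' p' q'"
proof -
  have *: "(2 * z - x) mod int m = (2 * z' - x') mod int m" if "x mod int m = x' mod int m" for x x'
    using that assms(2) by (intro mod_diff_cong mod_mult_cong refl)
  show ?thesis unfolding cob_def
    by (intro arg_cong2[where f = "(+)"] arg_cong2[where f = "(-)"] periodicD[OF assms(1)] * assms(2-))
qed

text \<open>An instance of the boundary of a boundary being zero: it gives \<open>cob g\<close> the
  last cocycle property.\<close>

lemma cob_cob:
  "cob g y p q - cob g (2 * z - y) (2 * z - p) (2 * z - q) = cob (cob g z) y p q"
  by (simp add: cob_def algebra_simps)

lemma cob_diff: "cob (\<lambda>p q. v p q - w p q) z p q = cob v z p q - cob w z p q"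
  by (simp add: cob_def algebra_simps)

lemma cob_add: "cob (\<lambda>p q. v p q + w p q) z p q = cob v z p q + cob w z p q"
  by (simp add: cob_def algebra_simps)

lemma cochain_add: "cochain v \<Longrightarrow> cochain w \<Longrightarrow> cochain (\<lambda>p q. v p q + w p q)"
  unfolding cochain_def periodic_def by (auto intro: B_add)

lemma cocycle_diff_cob:
  assumes \<psi>: "cocycle \<psi>" and g: "cochain g"
  shows "cocycle (\<lambda>z p q. \<psi> z p q - cob g z p q)"
  unfolding cocycle_def
proof (intro conjI allI)
  have per: "periodic g" and diag: "\<And>p. g p p \<in> B"
    using g by (auto simp: cochain_def)
  fix z y p q
  show "\<psi> (z mod int m) (p mod int m) (q mod int m) - cob g (z mod int m) (p mod int m) (q mod int m)
      = \<psi> z p q - cob g z p q"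
    by (intro arg_cong2[where f = "(-)"] cocycle_periodic[OF \<psi>] cob_periodic[OF per]) simp_all
  show "\<psi> z p p - cob g z p p \<in> B"
    unfolding cob_def by (simp add: B_diff B_add diag cocycle_diag[OF \<psi>])
  show "\<psi> z p (2 * z - p) - cob g z p (2 * z - p) \<in> B"
    unfolding cob_def by (simp add: cocycle_diag'[OF \<psi>])
  show "\<psi> y p q - cob g y p q
      - (\<psi> (2 * z - y) (2 * z - p) (2 * z - q) - cob g (2 * z - y) (2 * z - p) (2 * z - q))
      - cob (\<lambda>p q. \<psi> z p q - cob g z p q) y p q \<in> B"
    using cocycleD[OF \<psi>, of y p q z]
    unfolding cob_diff cob_cob[symmetric] by (simp add: algebra_simps)
qed

text \<open>Coboundaries are the principal crossed homomorphisms: modulo trivial functions, the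
  generator of index \<open>z\<close> goes to \<open>g\<close> minus its reflection in
  \<open>z\<close>.\<close>

lemma cob_triv_reflect:
  "triv (\<lambda>p q. cob g z p q - (g p q - g (2 * z - p) (2 * z - q)))"
  by (rule triv_potential[where l = "\<lambda>p. g p (2 * z - p)"]) (simp add: cob_def B_0)

text \<open>\<open>cob w z p q\<close> compares two paths from \<open>p\<close> to
  \<open>2 * z - q\<close>, one through \<open>q\<close> and one through
  \<open>2 * z - p\<close>.\<close>

lemma cob_of_triv:
  assumes "triv w"
  shows "cob w z p q \<in> B"
proof -
  have "cob w z p q = (w p q + w q (2 * z - q) - w p (2 * z - q))
      - (w p (2 * z - p) + w (2 * z - p) (2 * z - q) - w p (2 * z - q))"
    by (simp add: cob_def algebra_simps)
  also have "\<dots> \<in> B" by (rule B_diff; rule trivD[OF assms])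
  finally show ?thesis .
qed

text \<open>The cocycle identities with centre \<open>z\<close> at \<open>y\<close> and at
  \<open>2 * z - y\<close> express the two parts of the \<open>cob\<close> of this sum as opposite
  differences, because reflecting twice is the identity. So the sum is closed. For the crossed
  homomorphism this says that squares of generators have trivial value.\<close>

lemma triv_plus_reflect:
  assumes \<psi>: "cocycle \<psi>"
  shows "triv (\<lambda>p q. \<psi> z p q + \<psi> z (2 * z - p) (2 * z - q))"
proof (rule closed_imp_triv)
  show "cochain (\<lambda>p q. \<psi> z p q + \<psi> z (2 * z - p) (2 * z - q))"
    unfolding cochain_def periodic_def
    by (intro conjI allI B_add cocycle_diag[OF \<psi>] arg_cong2[where f = "(+)"] cocycle_periodic[OF \<psi>])
      (simp_all add: mod_simps)
  show "cob (\<lambda>p q. \<psi> z p q + \<psi> z (2 * z - p) (2 * z - q)) y p q \<in> B" for y p q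
  proof -
    have "cob (\<lambda>p q. \<psi> z p q + \<psi> z (2 * z - p) (2 * z - q)) y p q
        = cob (\<psi> z) y p q + cob (\<psi> z) (2 * z - y) (2 * z - p) (2 * z - q)"
      by (simp add: cob_def algebra_simps)
    also have "\<dots> = - (\<psi> y p q - \<psi> (2 * z - y) (2 * z - p) (2 * z - q) - cob (\<psi> z) y p q)
        - (\<psi> (2 * z - y) (2 * z - p) (2 * z - q)
          - \<psi> (2 * z - (2 * z - y)) (2 * z - (2 * z - p)) (2 * z - (2 * z - q))
          - cob (\<psi> z) (2 * z - y) (2 * z - p) (2 * z - q))"
      by (simp add: algebra_simps)
    also have "\<dots> \<in> B" by (intro B_diff B_uminus cocycleD[OF \<psi>])
    finally show ?thesis .
  qed
qed

text \<open>Modulo trivial functions, \<open>\<psi>\<close> is a crossed homomorphism on the group with generators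
  \<open>g\<^sub>z\<close> and relations \<open>g\<^sub>y g\<^sub>z = g\<^sub>z g\<^bsub>y * z\<^esub>\<close>, acting by reflections.\<close>

lemma triv_crossed:
  assumes \<psi>: "cocycle \<psi>"
  shows "triv (\<lambda>p q. \<psi> y p q + \<psi> z (2 * y - p) (2 * y - q)
    - (\<psi> z p q + \<psi> (2 * z - y) (2 * z - p) (2 * z - q)))"
proof (rule triv_potential[where l = "\<lambda>p. \<psi> z p (2 * y - p)"])
  fix p q
  show "\<psi> y p q + \<psi> z (2 * y - p) (2 * y - q)
    - (\<psi> z p q + \<psi> (2 * z - y) (2 * z - p) (2 * z - q))
    - (\<psi> z q (2 * y - q) - \<psi> z p (2 * y - p)) \<in> B"
    using cocycleD[OF \<psi>, of y p q z] by (simp add: cob_def algebra_simps)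
qed

text \<open>The value of that crossed homomorphism on the translation \<open>g\<^sub>k g\<^bsub>k + 1\<^esub>\<close>,
  which does not depend on \<open>k\<close>.\<close>

definition translation :: "(int \<Rightarrow> int \<Rightarrow> int \<Rightarrow> 'b) \<Rightarrow> int \<Rightarrow> int \<Rightarrow> int \<Rightarrow> 'b" where
  "translation \<psi> k p q = \<psi> k p q + \<psi> (k + 1) (2 * k - p) (2 * k - q)"

lemma translation_periodic: "cocycle \<psi> \<Longrightarrow> periodic (translation \<psi> k)"
  unfolding periodic_def translation_def
  by (intro allI arg_cong2[where f = "(+)"] cocycle_periodic) (simp_all add: mod_simps)

lemma translation_diag: "cocycle \<psi> \<Longrightarrow> translation \<psi> k p p \<in> B"
  unfolding translation_def by (intro B_add cocycle_diag)

text \<open>Since \<open>k * (k + 1) = k + 2\<close> in the quandle, the relation for indices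
  \<open>k\<close> and \<open>k + 1\<close> reads g_k g_{k+1} = g_{k+1} g_{k+2}.\<close>

lemma triv_translation_const:
  assumes \<psi>: "cocycle \<psi>"
  shows "triv (\<lambda>p q. translation \<psi> (int k) p q - translation \<psi> 0 p q)"
proof (induction k)
  case 0
  then show ?case by (simp add: triv_0)
next
  case (Suc k)
  show ?case
    by (rule triv_cong[OF triv_diff[OF Suc triv_crossed[OF \<psi>, of "int k" "int k + 1"]]])
      (simp add: translation_def algebra_simps)
qed

text \<open>In \<open>translation \<psi> k\<close> the second summand is replaced by the negative of
  its image under reflection in \<open>k + 1\<close>; the reflections in \<open>k\<close> and
  \<open>k + 1\<close> compose to the translation by 2.\<close>

lemma triv_step:
  assumes \<psi>: "cocycle \<psi>"
  shows "triv (\<lambda>p q. \<psi> (int k) p q - translation \<psi> 0 p q - \<psi> (int k + 1) (p + 2) (q + 2))"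
  by (rule triv_cong[OF triv_diff[OF triv_translation_const[OF \<psi>, of k]
        triv_reflect[OF triv_plus_reflect[OF \<psi>, of "int k + 1"], of "2 * int k"]]])
    (simp add: translation_def algebra_simps)

section \<open>The norm of the translation value and the invariant\<close>

definition norm_translation :: "(int \<Rightarrow> int \<Rightarrow> int \<Rightarrow> 'b) \<Rightarrow> int \<Rightarrow> int \<Rightarrow> 'b" where
  "norm_translation \<psi> p q = (\<Sum>i<m. translation \<psi> 0 (p + 2 * int i) (q + 2 * int i))"

text \<open>After \<open>m\<close> applications of \<open>triv_step\<close>, periodicity returns
  \<open>\<psi> 0\<close>; what has accumulated is the norm.\<close>

lemma triv_norm_translation:
  assumes \<psi>: "cocycle \<psi>"
  shows "triv (norm_translation \<psi>)"
proof -
  have iter: "triv (\<lambda>p q. \<psi> 0 p q - (\<Sum>i<k. translation \<psi> 0 (p + 2 * int i) (q + 2 * int i))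
      - \<psi> (int k) (p + 2 * int k) (q + 2 * int k))" for k
  proof (induction k)
    case 0
    then show ?case by (simp add: triv_0)
  next
    case (Suc k)
    show ?case
      by (rule triv_cong[OF triv_add[OF Suc triv_shift[OF triv_step[OF \<psi>, of k], of "2 * int k"]]])
        (simp add: algebra_simps)
  qed
  have "\<psi> (int m) (p + 2 * int m) (q + 2 * int m) = \<psi> 0 p q" for p q
    by (rule cocycle_periodic[OF \<psi>]) simp_all
  then show ?thesis
    by (intro triv_cong[OF triv_diff[OF triv_0 iter[of m]]]) (simp add: norm_translation_def)
qed

text \<open>As 2 generates the residues modulo \<open>m\<close>, the sum runs over a whole orbit of
  simultaneous translations and depends only on \<open>q - p\<close>.\<close>

lemma norm_shift:
  assumes per: "periodic w"
  shows "(\<Sum>i<m. w (p + 2 * int i) (q + 2 * int i)) - (\<Sum>i<m. w (2 * int i) (q - p + 2 * int i)) \<in> B"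
proof -
  define u where "u = q - p"
  define F where "F x = (\<Sum>i<m. w (x + 2 * int i) (x + u + 2 * int i))" for x
  have "F p - F 0 \<in> B"
  proof (rule step_const[where d = 2 and d' = half])
    show "F (x mod int m) = F x" for x
      unfolding F_def by (intro sum.cong refl periodicD[OF per] mod_add_cong) simp_all
    show "F (x + 2) - F x \<in> B" for x
    proof -
      let ?h = "\<lambda>i. w (x + 2 * int i) (x + u + 2 * int i)"
      have "F (x + 2) = (\<Sum>i<m. ?h (Suc i))"
        unfolding F_def by (intro sum.cong refl) (simp add: algebra_simps)
      moreover have "?h 0 + (\<Sum>i<m. ?h (Suc i)) = F x + ?h m"
        unfolding F_def by (rule trans[OF sum.lessThan_Suc_shift[symmetric] sum.lessThan_Suc])
      moreover have "?h m = ?h 0"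
        by (rule periodicD[OF per]) simp_all
      ultimately show ?thesis by (simp add: B_0)
    qed
  qed (simp add: two_half)
  then show ?thesis by (simp add: F_def u_def)
qed

lemma norm_translation_shift:
  "cocycle \<psi> \<Longrightarrow> norm_translation \<psi> p q - norm_translation \<psi> 0 (q - p) \<in> B"
  unfolding norm_translation_def using norm_shift[OF translation_periodic[of \<psi> 0], of p q] by simp

definition invariant :: "(int \<Rightarrow> int \<Rightarrow> int \<Rightarrow> 'b) \<Rightarrow> 'b" where
  "invariant \<psi> = norm_translation \<psi> 0 1"

text \<open>The norm is additive along paths and depends only on \<open>q - p\<close>, so it is
  linear in \<open>q - p\<close> with slope \<open>invariant \<psi>\<close>.\<close>

lemma norm_translation_invariant:
  assumes \<psi>: "cocycle \<psi>"
  shows "norm_translation \<psi> 0 (int j) - (\<Sum>i<j. invariant \<psi>) \<in> B"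
proof (induction j)
  case 0
  then show ?case by (simp add: norm_translation_def B_sum translation_diag[OF \<psi>])
next
  case (Suc j)
  let ?W = "norm_translation \<psi>"
  have "?W 0 (int (Suc j)) - (\<Sum>i<Suc j. invariant \<psi>)
      = (?W 0 (int j) - (\<Sum>i<j. invariant \<psi>))
      + (?W (int j) (int j + 1) - ?W 0 (int j + 1 - int j))
      - (?W 0 (int j) + ?W (int j) (int j + 1) - ?W 0 (int j + 1))"
    by (simp add: invariant_def algebra_simps)
  also have "\<dots> \<in> B"
    by (rule B_diff[OF B_add[OF Suc norm_translation_shift[OF \<psi>]] trivD[OF triv_norm_translation[OF \<psi>]]])
  finally show ?case .
qed

lemma norm_translation_periodic: "cocycle \<psi> \<Longrightarrow> periodic (norm_translation \<psi>)"
  unfolding periodic_def norm_translation_def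
  by (intro allI sum.cong refl periodicD[OF translation_periodic]) (simp_all add: mod_simps)

text \<open>By periodicity, the path from 0 to \<open>m\<close> in unit steps closes up.\<close>

lemma invariant_torsion:
  assumes \<psi>: "cocycle \<psi>"
  shows "(\<Sum>i<m. invariant \<psi>) \<in> B"
proof -
  have "norm_translation \<psi> 0 (int m) = norm_translation \<psi> 0 0"
    by (rule periodicD[OF norm_translation_periodic[OF \<psi>]]) simp_all
  also have "\<dots> \<in> B" by (simp add: norm_translation_def B_sum translation_diag[OF \<psi>])
  finally show ?thesis using B_diff norm_translation_invariant[OF \<psi>, of m] by fastforce
qed

lemma norm_translation_zero:
  assumes \<psi>: "cocycle \<psi>" and inv: "invariant \<psi> \<in> B"
  shows "norm_translation \<psi> p q \<in> B"
proof -
  have *: "norm_translation \<psi> 0 (int j) \<in> B" for j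
    using B_add[OF norm_translation_invariant[OF \<psi>, of j] B_sum[of "{..<j}" "\<lambda>_. invariant \<psi>"]] inv by simp
  have "norm_translation \<psi> 0 (q - p) = norm_translation \<psi> 0 (int (nat ((q - p) mod int m)))"
    using m_pos by (intro periodicD[OF norm_translation_periodic[OF \<psi>]]) simp_all
  then have "norm_translation \<psi> 0 (q - p) \<in> B" using * by metis
  from B_add[OF norm_translation_shift[OF \<psi>, of p q] this] show ?thesis by simp
qed

section \<open>Cocycles with vanishing invariant are coboundaries\<close>

lemma antidifference:
  assumes per: "periodic w" and diag: "\<And>p. w p p \<in> B"
    and norm: "\<And>p q. (\<Sum>i<m. w (p + 2 * int i) (q + 2 * int i)) \<in> B"
  obtains g where "cochain g" "\<And>p q. g p q - g (p + 2) (q + 2) - w p q \<in> B"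
proof
  \<comment> \<open>An additive Hilbert 90. Since \<open>p\<close> is congruent to
    \<open>2 * k p\<close>, the pair \<open>(p, q)\<close> is reached from \<open>(0, q - p)\<close>
    by \<open>k p\<close> translations by 2, and \<open>g\<close> is minus the partial sum of
    \<open>w\<close> along this orbit.\<close>
  define k where "k p = nat ((half * p) mod int m)" for p
  have k: "int (k p) = (half * p) mod int m" for p
    using m_pos by (simp add: k_def)
  have k_less: "k p < m" for p
    using m_pos by (simp add: k_def nat_less_iff)
  let ?h = "\<lambda>p q j. w (2 * int j) (q - p + 2 * int j)"
  define g where "g p q = - (\<Sum>j<k p. ?h p q j)" for p q
  have k_mod: "k (p mod int m) = k p" for p
    by (simp add: k_def mod_simps)
  show "cochain g"
    unfolding cochain_def periodic_def
  proof (intro conjI allI)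
    show "g (p mod int m) (q mod int m) = g p q" for p q
      unfolding g_def k_mod
      by (intro arg_cong[where f = uminus] sum.cong refl periodicD[OF per] mod_add_cong)
        (simp_all add: mod_simps)
    show "g p p \<in> B" for p
      unfolding g_def by (intro B_uminus B_sum) (simp add: diag)
  qed
  show "g p q - g (p + 2) (q + 2) - w p q \<in> B" for p q
  proof -
    have double: "(2 * int (k p)) mod int m = p mod int m"
    proof -
      have "(2 * int (k p)) mod int m = (2 * (half * p)) mod int m"
        unfolding k by (simp add: mod_simps)
      then show ?thesis unfolding two_half_mult by simp
    qed
    then have "(q - p + 2 * int (k p)) mod int m = (q - p + p) mod int m"
      by (metis mod_add_right_eq)
    then have w: "w p q = ?h p q (k p)"
      by (intro periodicD[OF per]) (simp_all add: double)
    have "half * (p + 2) = half * p + 1 + int m"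
      using two_half by (simp add: algebra_simps)
    then have "int (k (p + 2)) = (int (k p) + 1) mod int m"
      unfolding k by (simp add: mod_simps)
    then have k2: "k (p + 2) = Suc (k p) mod m"
      by (metis of_nat_Suc of_nat_eq_iff of_nat_mod add.commute)
    show ?thesis
    proof (cases "Suc (k p) < m")
      case True
      then have "k (p + 2) = Suc (k p)" using k2 by simp
      then show ?thesis by (simp add: g_def w B_0)
    next
      \<comment> \<open>Here \<open>k\<close> jumps from \<open>m - 1\<close> back to 0, and the
        discrepancy is the full norm.\<close>
      case False
      then have m: "m = Suc (k p)" using k_less[of p] by simp
      then have "k (p + 2) = 0" using k2 by simp
      then have "g p q - g (p + 2) (q + 2) - w p q = - (\<Sum>j<Suc (k p). ?h p q j)"
        by (simp add: g_def w)
      also have "\<dots> = - (\<Sum>j<m. w (0 + 2 * int j) (q - p + 2 * int j))"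
        unfolding m[symmetric] by simp
      also have "\<dots> \<in> B" by (intro B_uminus norm)
      finally show ?thesis .
    qed
  qed
qed

text \<open>The \<open>cob\<close> of a trivial function vanishes, so the cocycle identity becomes
  invariance under simultaneous reflections, hence translations, of all three arguments. Then
  \<open>\<psi>\<close> is determined by the one-variable function \<open>\<Lambda>\<close>, which
  is even because \<open>\<psi>\<close> vanishes on degenerate triples.\<close>

lemma coboundary_if_triv:
  assumes \<psi>: "cocycle \<psi>" and triv: "\<And>z. triv (\<psi> z)"
  obtains g where "cochain g" "\<And>z p q. \<psi> z p q - cob g z p q \<in> B"
proof
  define \<Lambda> where "\<Lambda> t = \<psi> 0 0 t" for t
  \<comment> \<open>For \<open>q = p * y\<close> the argument is congruent to
    \<open>p - y\<close>.\<close>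
  define g where "g p q = \<Lambda> (- (half * (q - p)))" for p q
  have \<Lambda>_periodic: "\<Lambda> t = \<Lambda> t'" if "t mod int m = t' mod int m" for t t'
    unfolding \<Lambda>_def by (intro cocycle_periodic[OF \<psi>] refl that)
  have reflect: "\<psi> y p q - \<psi> (2 * z - y) (2 * z - p) (2 * z - q) \<in> B" for y z p q
    using B_add[OF cocycleD[OF \<psi>, of y p q z] cob_of_triv[OF triv, of z y p q]] by simp
  have shift: "\<psi> z p q - \<psi> 0 (p - z) (q - z) \<in> B" for z p q
  proof -
    let ?k = "half * z"
    \<comment> \<open>Both \<open>(z, p, q)\<close> and its translate by \<open>- z\<close> are
      reflected to \<open>(- z, - p, - q)\<close>: the former in 0, the latter in
      \<open>- half * z\<close>.\<close>
    have "(\<psi> z p q - \<psi> (2 * 0 - z) (2 * 0 - p) (2 * 0 - q))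
        - (\<psi> (z - 2 * ?k) (p - 2 * ?k) (q - 2 * ?k)
           - \<psi> (2 * (- ?k) - (z - 2 * ?k)) (2 * (- ?k) - (p - 2 * ?k)) (2 * (- ?k) - (q - 2 * ?k))) \<in> B"
      by (rule B_diff; rule reflect)
    moreover have "\<psi> (z - 2 * ?k) (p - 2 * ?k) (q - 2 * ?k) = \<psi> 0 (p - z) (q - z)"
      unfolding two_half_mult
      by (intro cocycle_periodic[OF \<psi>]) (simp_all add: mod_eq_dvd_iff)
    ultimately show ?thesis by simp
  qed
  have \<psi>_\<Lambda>: "\<psi> z p q - (\<Lambda> (q - z) - \<Lambda> (p - z)) \<in> B" for z p q
  proof -
    have "\<psi> z p q - (\<Lambda> (q - z) - \<Lambda> (p - z)) = (\<psi> z p q - \<psi> 0 (p - z) (q - z))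
        + (\<psi> 0 0 (p - z) + \<psi> 0 (p - z) (q - z) - \<psi> 0 0 (q - z))"
      by (simp add: \<Lambda>_def)
    also have "\<dots> \<in> B" by (rule B_add[OF shift trivD[OF triv]])
    finally show ?thesis .
  qed
  have even: "\<Lambda> t - \<Lambda> (- t) \<in> B" for t
    using B_diff[OF cocycle_diag'[OF \<psi>, of 0 "- t"] \<psi>_\<Lambda>[of 0 "- t" t]] by simp
  show "cochain g"
    unfolding cochain_def periodic_def
  proof (intro conjI allI)
    show "g (p mod int m) (q mod int m) = g p q" for p q
      unfolding g_def by (intro \<Lambda>_periodic mod_minus_cong mod_mult_cong mod_diff_cong) simp_all
    show "g p p \<in> B" for p by (simp add: g_def \<Lambda>_def cocycle_diag[OF \<psi>])
  qed
  show "\<psi> z p q - cob g z p q \<in> B" for z p q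
  proof -
    have fold: "g x (2 * z - x) = \<Lambda> (x - z)" for x
    proof -
      have "- (half * (2 * z - x - x)) = 2 * (half * (x - z))" by (simp add: algebra_simps)
      then show ?thesis unfolding g_def two_half_mult by (intro \<Lambda>_periodic) simp
    qed
    have "2 * z - q - (2 * z - p) = - (q - p)" by simp
    then have "\<psi> z p q - cob g z p q = (\<psi> z p q - (\<Lambda> (q - z) - \<Lambda> (p - z)))
        - (\<Lambda> (- (half * (q - p))) - \<Lambda> (- (- (half * (q - p)))))"
      unfolding cob_def fold unfolding g_def by (simp only: mult_minus_right) simp
    also have "\<dots> \<in> B" by (rule B_diff[OF \<psi>_\<Lambda> even])
    finally show ?thesis .
  qed
qed

text \<open>Modulo trivial functions every \<open>\<psi> z\<close> equals
  \<open>w = \<psi> 0\<close>, which is odd under all reflections and so invariant under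
  translations. With \<open>m = 2 * n + 1\<close>, split \<open>w\<close> into \<open>m\<close>
  times \<open>w\<close>, which is the norm \<open>W\<close>, and \<open>- 2 * n\<close> times
  \<open>w\<close>, which is \<open>- n\<close> times \<open>w\<close> minus its reflection. It
  remains to write \<open>W\<close> as \<open>G (q - p) - G (p - q)\<close>.\<close>

lemma coboundary_if_triv_translation:
  assumes \<psi>: "cocycle \<psi>" and translation: "triv (translation \<psi> 0)"
  obtains g where "cochain g" "\<And>z p q. \<psi> z p q - cob g z p q \<in> B"
proof -
  define w where "w = \<psi> 0"
  have translation_k: "triv (translation \<psi> (int k))" for k
    by (rule triv_cong[OF triv_add[OF triv_translation_const[OF \<psi>, of k] translation]]) simp
  have step: "triv (\<lambda>p q. \<psi> (int k + 1) p q - \<psi> (int k) p q)" for k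
    by (rule triv_cong[OF triv_reflect[OF triv_diff[OF translation_k[of k] triv_plus_reflect[OF \<psi>, of "int k"]],
          of "2 * int k"]])
      (simp add: translation_def)
  have nat_const: "triv (\<lambda>p q. \<psi> (int k) p q - w p q)" for k
  proof (induction k)
    case 0
    then show ?case by (simp add: w_def triv_0)
  next
    case (Suc k)
    show ?case by (rule triv_cong[OF triv_add[OF step[of k] Suc]]) (simp add: algebra_simps)
  qed
  have const: "triv (\<lambda>p q. \<psi> z p q - w p q)" for z
  proof (rule triv_cong[OF nat_const[of "nat (z mod int m)"]])
    show "\<psi> z p q - w p q = \<psi> (int (nat (z mod int m))) p q - w p q" for p q
      using m_pos by (intro arg_cong2[where f = "(-)"] cocycle_periodic[OF \<psi>]) simp_all
  qed
  have reflect: "triv (\<lambda>p q. w p q + w (2 * z - p) (2 * z - q))" for z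
    by (rule triv_cong[OF triv_diff[OF triv_diff[OF triv_plus_reflect[OF \<psi>, of z] const]
            triv_reflect[OF const[of z], of "2 * z"]]])
      (simp add: algebra_simps)
  have shift: "triv (\<lambda>p q. w p q - w (p + 2 * int i) (q + 2 * int i))" for i
    by (rule triv_cong[OF triv_diff[OF reflect[of 0] triv_reflect[OF reflect[of "int i"], of 0]]])
      (simp add: algebra_simps)
  define W where "W p q = (\<Sum>i<m. w (p + 2 * int i) (q + 2 * int i))" for p q
  define n where "n = m div 2"
  have m: "m = Suc (n + n)"
    using odd_m by (auto simp: n_def elim!: oddE)
  define rep where "rep k x = (\<Sum>i<k. x)" for k :: nat and x :: 'b
  have rep_B: "x \<in> B \<Longrightarrow> rep k x \<in> B" for k x
    by (simp add: rep_def B_sum)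
  have rep_add: "rep (k + l) x = rep k x + rep l x" for k l x
    by (induction l) (simp_all add: rep_def add.assoc)
  have rep_m: "rep m x = x + (rep n x + rep n x)" for x
  proof -
    have "rep m x = rep (1 + (n + n)) x" using m by simp
    then show ?thesis unfolding rep_add by (simp add: rep_def)
  qed
  have w_periodic: "periodic w" and w_diag: "\<And>p. w p p \<in> B"
    using cocycle_cochain[OF \<psi>, of 0] by (simp_all add: cochain_def w_def)
  have W_periodic: "W p q = W p' q'"
    if "p mod int m = p' mod int m" "q mod int m = q' mod int m" for p q p' q'
    unfolding W_def by (intro sum.cong refl periodicD[OF w_periodic] mod_add_cong that)
  have W_shift: "W p q - W 0 (q - p) \<in> B" for p q
    using norm_shift[OF w_periodic, of p q] by (simp add: W_def)
  have M: "triv (\<lambda>p q. rep m (w p q) - W p q)"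
    by (rule triv_cong[OF triv_sum[where I = "{..<m}", OF shift]]) (simp add: rep_def W_def sum_subtractf)
  \<comment> \<open>Apply \<open>M\<close> to the path 0, \<open>- a\<close>, \<open>a\<close> with
    \<open>a = half * u\<close>. It gives \<open>W (- a) a - rep m (w (- a) a)\<close> for
    \<open>G u - G (- u)\<close>, and the second term is in \<open>B\<close> because it comes from a
    degenerate triple.\<close>
  define G where "G u = W 0 (half * u) - rep m (w 0 (half * u))" for u
  have G: "G u - G (- u) - W 0 u \<in> B" for u
  proof -
    define a where "a = half * u"
    have "2 * a = u + int m * u" unfolding a_def by (rule two_half_mult)
    then have W: "W 0 u = W 0 (a - - a)" by (intro W_periodic) simp_all
    have "G u - G (- u) - W 0 u = (rep m (w 0 (- a)) - W 0 (- a) + (rep m (w (- a) a) - W (- a) a)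
        - (rep m (w 0 a) - W 0 a)) - rep m (w (- a) a) + (W (- a) a - W 0 (a - - a))"
      unfolding W by (simp add: G_def a_def algebra_simps)
    also have "\<dots> \<in> B"
      using rep_B[OF cocycle_diag'[OF \<psi>, of 0 "- a"]]
      by (intro B_add[OF B_diff[OF trivD[OF M]] W_shift]) (simp add: w_def)
    finally show ?thesis .
  qed
  have G': "triv (\<lambda>p q. G (q - p) - G (p - q) - W p q)"
  proof (rule triv_potential[where l = "\<lambda>_. 0"])
    show "G (q - p) - G (p - q) - W p q - (0 - 0) \<in> B" for p q
      using B_diff[OF G[of "q - p"] W_shift[of p q]] by (simp add: algebra_simps)
  qed
  define g where "g p q = G (q - p) - rep n (w p q)" for p q
  have g: "cochain g"
    unfolding cochain_def periodic_def
  proof (intro conjI allI)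
    have "G (q mod int m - p mod int m) = G (q - p)" for p q
      unfolding G_def
      by (intro arg_cong2[where f = "(-)"] arg_cong[where f = "rep m"] W_periodic
          periodicD[OF w_periodic] mod_mult_cong) (simp_all add: mod_simps)
    then show "g (p mod int m) (q mod int m) = g p q" for p q
      using w_periodic by (simp add: g_def periodic_def)
    show "g p p \<in> B" for p
      unfolding g_def G_def W_def by (simp add: B_diff B_sum rep_B w_diag)
  qed
  have w_reflect: "triv (\<lambda>p q. rep n (w p q) + rep n (w (2 * z - p) (2 * z - q)))" for z
    by (rule triv_cong[OF triv_sum[where I = "{..<n}", OF reflect[of z]]]) (simp add: rep_def sum.distrib)
  have "triv (\<lambda>p q. \<psi> z p q - cob g z p q)" for z
    by (rule triv_cong[OF triv_diff[OF triv_add[OF const[of z] M]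
          triv_add[OF cob_triv_reflect[of g z] triv_add[OF G' w_reflect[of z]]]]])
      (simp add: g_def rep_m algebra_simps)
  then obtain h where "cochain h" "\<And>z p q. \<psi> z p q - cob g z p q - cob h z p q \<in> B"
    using coboundary_if_triv[OF cocycle_diff_cob[OF \<psi> g]] by blast
  then show ?thesis
    by (intro that[OF cochain_add[OF g]]) (simp_all add: cob_add diff_diff_eq)
qed

text \<open>If the invariant vanishes, so does the norm, and the translation value is
  \<open>g\<^sub>0\<close> minus its shift by 2. This is also the translation value of
  \<open>cob g\<^sub>0\<close> modulo trivial functions, so subtracting \<open>cob g\<^sub>0\<close>
  leaves a cocycle with trivial translation value.\<close>

theorem cocycle_coboundary:
  assumes \<psi>: "cocycle \<psi>" and inv: "invariant \<psi> \<in> B"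
  obtains g where "cochain g" "\<And>z p q. \<psi> z p q - cob g z p q \<in> B"
proof -
  obtain g\<^sub>0 where g0: "cochain g\<^sub>0"
      "\<And>p q. g\<^sub>0 p q - g\<^sub>0 (p + 2) (q + 2) - translation \<psi> 0 p q \<in> B"
    using antidifference[OF translation_periodic[OF \<psi>, of 0] translation_diag[OF \<psi>, of 0]]
      norm_translation_zero[OF \<psi> inv] unfolding norm_translation_def by blast
  let ?\<phi> = "\<lambda>z p q. \<psi> z p q - cob g\<^sub>0 z p q"
  have \<phi>: "cocycle ?\<phi>" by (rule cocycle_diff_cob[OF \<psi> g0(1)])
  have "triv (translation ?\<phi> 0)"
  proof (rule triv_potential[where l = "\<lambda>p. - g\<^sub>0 p (- p) - g\<^sub>0 (- p) (2 + p)"])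
    show "translation ?\<phi> 0 p q - (- g\<^sub>0 q (- q) - g\<^sub>0 (- q) (2 + q) - (- g\<^sub>0 p (- p) - g\<^sub>0 (- p) (2 + p))) \<in> B"
      for p q
      using B_uminus[OF g0(2)[of p q]] by (simp add: translation_def cob_def algebra_simps)
  qed
  then obtain g\<^sub>1 where g1: "cochain g\<^sub>1" "\<And>z p q. ?\<phi> z p q - cob g\<^sub>1 z p q \<in> B"
    using coboundary_if_triv_translation[OF \<phi>] by blast
  show ?thesis
  proof (rule that)
    show "cochain (\<lambda>p q. g\<^sub>0 p q + g\<^sub>1 p q)" by (rule cochain_add[OF g0(1) g1(1)])
    show "\<psi> z p q - cob (\<lambda>p q. g\<^sub>0 p q + g\<^sub>1 p q) z p q \<in> B" for z p q
      unfolding cob_add using g1(2)[of z p q] by (simp add: algebra_simps)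
  qed
qed

end

section \<open>Quandle homology through chains\<close>

lemma degenerate_subset: "degenerate_tuples X n \<subseteq> tuples X n"
  by (auto simp: degenerate_tuples_def)

text \<open>Degenerate tuples are part of the basis, so membership in the subgroup they generate is
  a condition on supports. All coset computations below use this form.\<close>

lemma degenerate_chains_eq:
  "degenerate_chains X n = {c. Poly_Mapping.keys c \<subseteq> degenerate_tuples X n}" (is "_ = ?D")
proof
  let ?G = "rack_chain_group X n"
  have G: "group ?G" by (simp add: rack_chain_group_def)
  have gens: "frag_of ` degenerate_tuples X n \<subseteq> carrier ?G"
    using degenerate_subset by (fastforce simp: rack_chain_group_def)
  show "degenerate_chains X n \<subseteq> ?D"
  proof
    fix c assume "c \<in> degenerate_chains X n"
    then have "c \<in> generate ?G (frag_of ` degenerate_tuples X n)"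
      by (simp add: degenerate_chains_def)
    then show "c \<in> ?D"
    proof induction
      case (inv h)
      then show ?case
        using degenerate_subset[of X n] by (auto simp: rack_chain_group_def)
    next
      case (eng h1 h2)
      then show ?case
        using keys_add[of h1 h2] by (auto simp: rack_chain_group_def)
    qed (auto simp: rack_chain_group_def)
  qed
  have sub: "subgroup (degenerate_chains X n) ?G"
    unfolding degenerate_chains_def by (rule group.generate_is_subgroup[OF G gens])
  show "?D \<subseteq> degenerate_chains X n"
  proof safe
    fix c :: "'a list \<Rightarrow>\<^sub>0 int"
    assume "Poly_Mapping.keys c \<subseteq> degenerate_tuples X n"
    then show "c \<in> degenerate_chains X n"
    proof (induction c rule: frag_induction)
      case zero
      then show ?case using subgroup.one_closed[OF sub] by (simp add: rack_chain_group_def)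
    next
      case (one x)
      then show ?case unfolding degenerate_chains_def by (intro generate.incl) simp
    next
      case (diff a b)
      then have "inv\<^bsub>?G\<^esub> b = - b"
        using subgroup.mem_carrier[OF sub, of b] by (simp add: rack_chain_group_def)
      then have "a - b = a \<otimes>\<^bsub>?G\<^esub> inv\<^bsub>?G\<^esub> b"
        by (simp add: rack_chain_group_def)
      then show ?case
        using diff subgroup.m_closed[OF sub] subgroup.m_inv_closed[OF sub] by simp
    qed
  qed
qed

lemma degenerate_normal: "degenerate_chains X n \<lhd> rack_chain_group X n"
proof -
  have "comm_group (rack_chain_group X n)"
    by (simp add: rack_chain_group_def abelian_free_Abelian_group)
  then show ?thesis
    unfolding degenerate_chains_def
    by (intro comm_group.subgroup_imp_normal group.generate_is_subgroup)
      (use degenerate_subset in \<open>fastforce simp: rack_chain_group_def comm_group_def\<close>)+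
qed

definition chain_coset :: "'a set \<Rightarrow> nat \<Rightarrow> ('a list \<Rightarrow>\<^sub>0 int) \<Rightarrow> ('a list \<Rightarrow>\<^sub>0 int) set" where
  "chain_coset X n c = degenerate_chains X n #>\<^bsub>rack_chain_group X n\<^esub> c"

lemma mem_chain_coset:
  "a \<in> chain_coset X n c \<longleftrightarrow> Poly_Mapping.keys (a - c) \<subseteq> degenerate_tuples X n"
proof -
  have "a \<in> chain_coset X n c \<longleftrightarrow> (\<exists>e. Poly_Mapping.keys e \<subseteq> degenerate_tuples X n \<and> a = e + c)"
    by (auto simp: chain_coset_def r_coset_def degenerate_chains_eq rack_chain_group_def)
  also have "\<dots> \<longleftrightarrow> Poly_Mapping.keys (a - c) \<subseteq> degenerate_tuples X n"
    by (metis add_diff_cancel_right' diff_add_cancel)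
  finally show ?thesis .
qed

lemma keys_diff_subset:
  "Poly_Mapping.keys a \<subseteq> S \<Longrightarrow> Poly_Mapping.keys b \<subseteq> S \<Longrightarrow> Poly_Mapping.keys (a - b) \<subseteq> S"
  for a b :: "'a \<Rightarrow>\<^sub>0 int"
  using keys_diff[of a b] by blast

lemma keys_add_subset:
  "Poly_Mapping.keys a \<subseteq> S \<Longrightarrow> Poly_Mapping.keys b \<subseteq> S \<Longrightarrow> Poly_Mapping.keys (a + b) \<subseteq> S"
  for a b :: "'a \<Rightarrow>\<^sub>0 int"
  using keys_add[of a b] by blast

lemma chain_coset_eq_iff:
  "chain_coset X n a = chain_coset X n b \<longleftrightarrow> Poly_Mapping.keys (a - b) \<subseteq> degenerate_tuples X n"
proof
  assume "chain_coset X n a = chain_coset X n b"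
  moreover have "a \<in> chain_coset X n a" by (simp add: mem_chain_coset)
  ultimately show "Poly_Mapping.keys (a - b) \<subseteq> degenerate_tuples X n"
    by (simp add: mem_chain_coset)
next
  assume ab: "Poly_Mapping.keys (a - b) \<subseteq> degenerate_tuples X n"
  have "Poly_Mapping.keys (c - a) \<subseteq> degenerate_tuples X n
      \<longleftrightarrow> Poly_Mapping.keys (c - b) \<subseteq> degenerate_tuples X n" for c
    using keys_add_subset[OF _ ab, of "c - a"] keys_diff_subset[OF _ ab, of "c - b"] by auto
  then show "chain_coset X n a = chain_coset X n b"
    by (auto simp: mem_chain_coset)
qed

lemma carrier_quandle_chain_group:
  "carrier (quandle_chain_group X n) = chain_coset X n ` {c. Poly_Mapping.keys c \<subseteq> tuples X n}"
  by (auto simp: quandle_chain_group_def FactGroup_def RCOSETS_def chain_coset_def rack_chain_group_def)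

lemma mult_quandle_chain_group:
  assumes "Poly_Mapping.keys a \<subseteq> tuples X n" "Poly_Mapping.keys b \<subseteq> tuples X n"
  shows "chain_coset X n a \<otimes>\<^bsub>quandle_chain_group X n\<^esub> chain_coset X n b = chain_coset X n (a + b)"
  using normal.rcos_sum[OF degenerate_normal, of a X n b] assms
  by (simp add: quandle_chain_group_def FactGroup_def chain_coset_def rack_chain_group_def)

lemma one_quandle_chain_group: "\<one>\<^bsub>quandle_chain_group X n\<^esub> = chain_coset X n 0"
proof -
  have "\<one>\<^bsub>quandle_chain_group X n\<^esub> = degenerate_chains X n"
    by (simp add: quandle_chain_group_def FactGroup_def)
  also have "\<dots> = chain_coset X n 0"
    by (auto simp: mem_chain_coset degenerate_chains_eq)
  finally show ?thesis .
qed

lemma group_quandle_chain_group: "group (quandle_chain_group X n)"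
  unfolding quandle_chain_group_def by (rule normal.factorgroup_is_group[OF degenerate_normal])

lemma the_elem_image_coset:
  assumes "\<And>e. Poly_Mapping.keys (e - c) \<subseteq> degenerate_tuples X n \<Longrightarrow> f e = f c"
  shows "the_elem (f ` chain_coset X n c) = f c"
proof -
  have "c \<in> chain_coset X n c" by (simp add: mem_chain_coset)
  moreover have "f x = f c" if "x \<in> chain_coset X n c" for x
    using that by (intro assms) (simp add: mem_chain_coset)
  ultimately have "f ` chain_coset X n c = {f c}" by blast
  then show ?thesis by simp
qed

lemma rack_boundary_diff: "rack_boundary op (a - b) = rack_boundary op a - rack_boundary op b"
  by (simp add: rack_boundary_def frag_extend_diff)

lemma rack_boundary_add: "rack_boundary op (a + b) = rack_boundary op a + rack_boundary op b"
  by (simp add: rack_boundary_def frag_extend_add)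

lemma quandle_boundary_coset:
  assumes "\<And>e. Poly_Mapping.keys e \<subseteq> degenerate_tuples X (Suc n) \<Longrightarrow>
      Poly_Mapping.keys (rack_boundary op e) \<subseteq> degenerate_tuples X n"
  shows "quandle_boundary X op (Suc n) (chain_coset X (Suc n) c) = chain_coset X n (rack_boundary op c)"
  unfolding quandle_boundary_def chain_coset_def[symmetric] diff_Suc_1
  by (rule the_elem_image_coset)
    (simp only: chain_coset_eq_iff rack_boundary_diff[symmetric] assms)

text \<open>The first isomorphism theorem, with all hypotheses on representatives.\<close>

lemma quandle_homology_iso:
  fixes op :: "'a \<Rightarrow> 'a \<Rightarrow> 'a" and H :: "'b monoid"
  assumes chain: "\<And>c. Poly_Mapping.keys c \<subseteq> tuples X (Suc n) \<Longrightarrow>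
      Poly_Mapping.keys (rack_boundary op c) \<subseteq> tuples X n"
    and chain': "\<And>d. Poly_Mapping.keys d \<subseteq> tuples X (Suc (Suc n)) \<Longrightarrow>
      Poly_Mapping.keys (rack_boundary op d) \<subseteq> tuples X (Suc n)"
    and degen: "\<And>c. Poly_Mapping.keys c \<subseteq> degenerate_tuples X (Suc n) \<Longrightarrow>
      Poly_Mapping.keys (rack_boundary op c) \<subseteq> degenerate_tuples X n"
    and degen': "\<And>d. Poly_Mapping.keys d \<subseteq> degenerate_tuples X (Suc (Suc n)) \<Longrightarrow>
      Poly_Mapping.keys (rack_boundary op d) \<subseteq> degenerate_tuples X (Suc n)"
    and complex: "\<And>d. Poly_Mapping.keys d \<subseteq> tuples X (Suc (Suc n)) \<Longrightarrow>
      rack_boundary op (rack_boundary op d) = 0"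
    and H: "group H"
    and hom: "\<phi> \<in> hom (rack_chain_group X (Suc n)) H"
    and surj: "\<And>y. y \<in> carrier H \<Longrightarrow> \<exists>c. Poly_Mapping.keys c \<subseteq> tuples X (Suc n) \<and>
      Poly_Mapping.keys (rack_boundary op c) \<subseteq> degenerate_tuples X n \<and> \<phi> c = y"
    and ker: "\<And>c. Poly_Mapping.keys c \<subseteq> tuples X (Suc n) \<Longrightarrow>
      Poly_Mapping.keys (rack_boundary op c) \<subseteq> degenerate_tuples X n \<Longrightarrow>
      \<phi> c = \<one>\<^bsub>H\<^esub> \<longleftrightarrow> (\<exists>d. Poly_Mapping.keys d \<subseteq> tuples X (Suc (Suc n)) \<and>
        Poly_Mapping.keys (c - rack_boundary op d) \<subseteq> degenerate_tuples X (Suc n))"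
  shows "quandle_homology X op (Suc n) \<cong> H"
proof -
  let ?Q = "quandle_chain_group X"
  let ?Z = "{c. Poly_Mapping.keys c \<subseteq> tuples X (Suc n) \<and>
      Poly_Mapping.keys (rack_boundary op c) \<subseteq> degenerate_tuples X n}"
  have bd: "quandle_boundary X op (Suc n) (chain_coset X (Suc n) c) = chain_coset X n (rack_boundary op c)" for c
    by (rule quandle_boundary_coset[OF degen])
  have bd': "quandle_boundary X op (Suc (Suc n)) (chain_coset X (Suc (Suc n)) d) = chain_coset X (Suc n) (rack_boundary op d)"
    for d
    by (rule quandle_boundary_coset[OF degen'])
  have "group_hom (?Q (Suc n)) (?Q n) (quandle_boundary X op (Suc n))"
  proof (intro group_hom.intro group_hom_axioms.intro group_quandle_chain_group homI)
    show "quandle_boundary X op (Suc n) S \<in> carrier (?Q n)" if "S \<in> carrier (?Q (Suc n))" for S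
      using that by (auto simp: carrier_quandle_chain_group bd chain)
    show "quandle_boundary X op (Suc n) (S \<otimes>\<^bsub>?Q (Suc n)\<^esub> T)
        = quandle_boundary X op (Suc n) S \<otimes>\<^bsub>?Q n\<^esub> quandle_boundary X op (Suc n) T"
      if "S \<in> carrier (?Q (Suc n))" "T \<in> carrier (?Q (Suc n))" for S T
      using that by (auto simp: carrier_quandle_chain_group bd chain mult_quandle_chain_group
          rack_boundary_add)
  qed
  then have "subgroup (quandle_cycles X op (Suc n)) (?Q (Suc n))"
    unfolding quandle_cycles_def diff_Suc_1 by (rule group_hom.subgroup_kernel)
  then have G: "group ((?Q (Suc n))\<lparr>carrier := quandle_cycles X op (Suc n)\<rparr>)" (is "group ?G")
    by (rule subgroup.subgroup_is_group[OF _ group_quandle_chain_group])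
  have cycles: "quandle_cycles X op (Suc n) = chain_coset X (Suc n) ` ?Z"
  proof -
    have "quandle_cycles X op (Suc n)
        = {S \<in> chain_coset X (Suc n) ` {c. Poly_Mapping.keys c \<subseteq> tuples X (Suc n)}.
            quandle_boundary X op (Suc n) S = chain_coset X n 0}"
      by (simp add: quandle_cycles_def kernel_def carrier_quandle_chain_group one_quandle_chain_group)
    also have "\<dots> = chain_coset X (Suc n) ` {c. Poly_Mapping.keys c \<subseteq> tuples X (Suc n) \<and>
        quandle_boundary X op (Suc n) (chain_coset X (Suc n) c) = chain_coset X n 0}"
      by blast
    finally show ?thesis by (simp add: bd chain_coset_eq_iff)
  qed
  have \<phi>_add: "\<phi> (a + b) = \<phi> a \<otimes>\<^bsub>H\<^esub> \<phi> b"
    if "Poly_Mapping.keys a \<subseteq> tuples X (Suc n)" "Poly_Mapping.keys b \<subseteq> tuples X (Suc n)" for a b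
    using hom_mult[OF hom, of a b] that by (simp add: rack_chain_group_def)
  have \<phi>_closed: "\<phi> a \<in> carrier H" if "Poly_Mapping.keys a \<subseteq> tuples X (Suc n)" for a
    using hom_in_carrier[OF hom, of a] that by (simp add: rack_chain_group_def)
  define h where "h S = the_elem (\<phi> ` S)" for S
  have h: "h (chain_coset X (Suc n) c) = \<phi> c" if c: "Poly_Mapping.keys c \<subseteq> tuples X (Suc n)" for c
    unfolding h_def
  proof (rule the_elem_image_coset)
    fix e assume e: "Poly_Mapping.keys (e - c) \<subseteq> degenerate_tuples X (Suc n)"
    \<comment> \<open>A degenerate chain is a relative cycle, and \<open>d = 0\<close> witnesses
      that it is null; so \<open>ker\<close> makes \<open>\<phi>\<close> constant on cosets.\<close>
    have "\<phi> (e - c) = \<one>\<^bsub>H\<^esub>"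
      using e degenerate_subset[of X "Suc n"] degen[OF e]
      by (subst ker) (auto intro!: exI[of _ 0] simp: rack_boundary_def)
    then show "\<phi> e = \<phi> c"
      using \<phi>_add[of "e - c" c] \<phi>_closed[OF c] e c degenerate_subset[of X "Suc n"] H
      by (simp add: group.is_monoid monoid.l_one subset_trans)
  qed
  have "group_hom ?G H h"
  proof (intro group_hom.intro group_hom_axioms.intro G H homI)
    show "h S \<in> carrier H" if "S \<in> carrier ?G" for S
      using that by (auto simp: cycles h \<phi>_closed)
    show "h (S \<otimes>\<^bsub>?G\<^esub> T) = h S \<otimes>\<^bsub>H\<^esub> h T" if "S \<in> carrier ?G" "T \<in> carrier ?G" for S T
      using that by (auto simp: cycles h \<phi>_add mult_quandle_chain_group keys_add_subset)
  qed
  moreover have "h ` carrier ?G = carrier H"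
  proof
    show "h ` carrier ?G \<subseteq> carrier H" by (auto simp: cycles h \<phi>_closed)
    show "carrier H \<subseteq> h ` carrier ?G"
    proof
      fix y assume "y \<in> carrier H"
      then obtain c where "c \<in> ?Z" "\<phi> c = y" using surj by blast
      then have "y = h (chain_coset X (Suc n) c)" "chain_coset X (Suc n) c \<in> carrier ?G"
        by (simp_all add: cycles h)
      then show "y \<in> h ` carrier ?G" by blast
    qed
  qed
  ultimately have "?G Mod kernel ?G H h \<cong> H" by (rule group_hom.FactGroup_iso)
  moreover have "kernel ?G H h = quandle_boundaries X op (Suc n)"
  proof -
    have "kernel ?G H h = chain_coset X (Suc n) ` {c \<in> ?Z. \<phi> c = \<one>\<^bsub>H\<^esub>}"
      by (auto simp: kernel_def cycles h)
    also have "\<dots> = chain_coset X (Suc n) ` rack_boundary op ` {d. Poly_Mapping.keys d \<subseteq> tuples X (Suc (Suc n))}"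
    proof (intro equalityI subsetI)
      fix S assume "S \<in> chain_coset X (Suc n) ` {c \<in> ?Z. \<phi> c = \<one>\<^bsub>H\<^esub>}"
      then obtain c where "c \<in> ?Z" "\<phi> c = \<one>\<^bsub>H\<^esub>" "S = chain_coset X (Suc n) c" by auto
      then show "S \<in> chain_coset X (Suc n) ` rack_boundary op ` {d. Poly_Mapping.keys d \<subseteq> tuples X (Suc (Suc n))}"
        using ker[of c] by (auto simp flip: chain_coset_eq_iff)
    next
      fix S assume "S \<in> chain_coset X (Suc n) ` rack_boundary op ` {d. Poly_Mapping.keys d \<subseteq> tuples X (Suc (Suc n))}"
      then obtain d where d: "Poly_Mapping.keys d \<subseteq> tuples X (Suc (Suc n))"
        and S: "S = chain_coset X (Suc n) (rack_boundary op d)" by auto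
      have "rack_boundary op d \<in> {c \<in> ?Z. \<phi> c = \<one>\<^bsub>H\<^esub>}"
        using chain'[OF d] complex[OF d] d ker[of "rack_boundary op d"] by (auto intro!: exI[of _ d])
      then show "S \<in> chain_coset X (Suc n) ` {c \<in> ?Z. \<phi> c = \<one>\<^bsub>H\<^esub>}" using S by blast
    qed
    also have "\<dots> = quandle_boundaries X op (Suc n)"
      by (auto simp: quandle_boundaries_def carrier_quandle_chain_group image_image bd')
    finally show ?thesis .
  qed
  ultimately show ?thesis by (simp add: quandle_homology_def)
qed

section \<open>Boundaries of 3-chains and 4-chains\<close>

lemma rack_boundary_of [simp]: "rack_boundary op (frag_of xs) = tuple_boundary op xs"
  by (simp add: rack_boundary_def)

lemma tuple_boundary_3:
  "tuple_boundary op [x, y, z] = frag_of [op x y, z] - frag_of [x, z]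
     - (frag_of [op x z, op y z] - frag_of [x, y])"
  by (simp add: tuple_boundary_def sum.atLeast_Suc_atMost numeral_nat)

lemma tuple_boundary_4:
  "tuple_boundary op [x, y, z, w] = frag_of [op x y, z, w] - frag_of [x, z, w]
     - (frag_of [op x z, op y z, w] - frag_of [x, y, w])
     + (frag_of [op x w, op y w, op z w] - frag_of [x, y, z])"
  by (simp add: tuple_boundary_def sum.atLeast_Suc_atMost numeral_nat)

lemma tuples_2: "tuples X 2 = {[x, y] | x y. x \<in> X \<and> y \<in> X}"
  by (auto simp: tuples_def length_Suc_conv numeral_nat)

lemma tuples_3: "tuples X 3 = {[x, y, z] | x y z. x \<in> X \<and> y \<in> X \<and> z \<in> X}"
  by (auto simp: tuples_def length_Suc_conv numeral_nat)

lemma tuples_4: "tuples X 4 = {[x, y, z, w] | x y z w. x \<in> X \<and> y \<in> X \<and> z \<in> X \<and> w \<in> X}"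
  by (auto simp: tuples_def length_Suc_conv numeral_nat)

lemma degenerate_2: "[x, y] \<in> degenerate_tuples X 2 \<longleftrightarrow> x \<in> X \<and> y = x"
  by (auto simp: degenerate_tuples_def tuples_2)

lemma degenerate_3:
  "[x, y, z] \<in> degenerate_tuples X 3 \<longleftrightarrow> x \<in> X \<and> y \<in> X \<and> z \<in> X \<and> (x = y \<or> y = z)"
proof -
  have "(\<exists>i. Suc i < 3 \<and> P i) \<longleftrightarrow> P 0 \<or> P 1" for P :: "nat \<Rightarrow> bool"
    by (auto simp: numeral_nat less_Suc_eq)
  then show ?thesis by (auto simp: degenerate_tuples_def tuples_3)
qed

lemma degenerate_4:
  "[x, y, z, w] \<in> degenerate_tuples X 4 \<longleftrightarrow>
     x \<in> X \<and> y \<in> X \<and> z \<in> X \<and> w \<in> X \<and> (x = y \<or> y = z \<or> z = w)"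
proof -
  have "(\<exists>i. Suc i < 4 \<and> P i) \<longleftrightarrow> P 0 \<or> P 1 \<or> P 2" for P :: "nat \<Rightarrow> bool"
    by (auto simp: numeral_nat less_Suc_eq)
  then show ?thesis by (auto simp: degenerate_tuples_def tuples_4)
qed

lemma keys_extend_subset:
  assumes "Poly_Mapping.keys c \<subseteq> S" "\<And>x. x \<in> S \<Longrightarrow> Poly_Mapping.keys (f x) \<subseteq> T"
  shows "Poly_Mapping.keys (frag_extend f c) \<subseteq> T"
  using keys_frag_extend[of f c] assms by blast

context quandle
begin

lemma boundary_tuples_3:
  assumes "Poly_Mapping.keys c \<subseteq> tuples X 3"
  shows "Poly_Mapping.keys (rack_boundary op c) \<subseteq> tuples X 2"
  unfolding rack_boundary_def using assms
proof (rule keys_extend_subset)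
  fix xs assume "xs \<in> tuples X 3"
  then obtain x y z where xs: "xs = [x, y, z]" and "x \<in> X" "y \<in> X" "z \<in> X"
    by (auto simp: tuples_3)
  then show "Poly_Mapping.keys (tuple_boundary op xs) \<subseteq> tuples X 2"
    unfolding xs tuple_boundary_3 by (intro keys_diff_subset) (simp_all add: tuples_2 closed)
qed

lemma boundary_tuples_4:
  assumes "Poly_Mapping.keys c \<subseteq> tuples X 4"
  shows "Poly_Mapping.keys (rack_boundary op c) \<subseteq> tuples X 3"
  unfolding rack_boundary_def using assms
proof (rule keys_extend_subset)
  fix xs assume "xs \<in> tuples X 4"
  then obtain x y z w where xs: "xs = [x, y, z, w]" and "x \<in> X" "y \<in> X" "z \<in> X" "w \<in> X"
    by (auto simp: tuples_4)
  then show "Poly_Mapping.keys (tuple_boundary op xs) \<subseteq> tuples X 3"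
    unfolding xs tuple_boundary_4
    by (intro keys_diff_subset keys_add_subset) (simp_all add: tuples_3 closed)
qed

lemma boundary_degenerate_3:
  assumes "Poly_Mapping.keys c \<subseteq> degenerate_tuples X 3"
  shows "Poly_Mapping.keys (rack_boundary op c) \<subseteq> degenerate_tuples X 2"
  unfolding rack_boundary_def using assms
proof (rule keys_extend_subset)
  fix xs assume xs: "xs \<in> degenerate_tuples X 3"
  then obtain x y z where "xs = [x, y, z]" by (auto simp: degenerate_tuples_def tuples_3)
  moreover from this xs have "x \<in> X" "y \<in> X" "z \<in> X" "x = y \<or> y = z"
    by (simp_all add: degenerate_3)
  ultimately show "Poly_Mapping.keys (tuple_boundary op xs) \<subseteq> degenerate_tuples X 2"
    by (elim disjE; simp add: tuple_boundary_3 idem)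
      (intro keys_diff_subset; simp add: degenerate_2 closed)
qed

lemma boundary_degenerate_4:
  assumes "Poly_Mapping.keys c \<subseteq> degenerate_tuples X 4"
  shows "Poly_Mapping.keys (rack_boundary op c) \<subseteq> degenerate_tuples X 3"
  unfolding rack_boundary_def using assms
proof (rule keys_extend_subset)
  fix xs assume xs: "xs \<in> degenerate_tuples X 4"
  then obtain x y z w where "xs = [x, y, z, w]" by (auto simp: degenerate_tuples_def tuples_4)
  moreover from this xs have "x \<in> X" "y \<in> X" "z \<in> X" "w \<in> X" "x = y \<or> y = z \<or> z = w"
    by (simp_all add: degenerate_4)
  ultimately show "Poly_Mapping.keys (tuple_boundary op xs) \<subseteq> degenerate_tuples X 3"
    by (elim disjE; simp add: tuple_boundary_4 idem)
      (intro keys_diff_subset keys_add_subset; simp add: degenerate_3 closed idem)+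
qed

text \<open>Self-distributivity identifies the iterated faces, which then cancel in pairs.\<close>

lemma boundary_boundary_4:
  assumes "Poly_Mapping.keys c \<subseteq> tuples X 4"
  shows "rack_boundary op (rack_boundary op c) = 0"
  using assms
proof (induction c rule: frag_induction)
  case zero
  then show ?case by (simp add: rack_boundary_def)
next
  case (one xs)
  then obtain x y z w where xs: "xs = [x, y, z, w]" "x \<in> X" "y \<in> X" "z \<in> X" "w \<in> X"
    by (auto simp: tuples_4)
  have "op (op x y) z = op (op x z) (op y z)" "op (op x y) w = op (op x w) (op y w)"
    "op (op x z) w = op (op x w) (op z w)" "op (op y z) w = op (op y w) (op z w)"
    using xs self_distrib by auto
  then show ?case
    by (simp add: xs tuple_boundary_4 tuple_boundary_3 rack_boundary_diff rack_boundary_add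
        algebra_simps)
next
  case (diff a b)
  then show ?case by (simp add: rack_boundary_diff)
qed

end

section \<open>The dihedral quandle\<close>

definition int_extend :: "('a \<Rightarrow> int) \<Rightarrow> ('a \<Rightarrow>\<^sub>0 int) \<Rightarrow> int" where
  "int_extend f c = (\<Sum>x\<in>Poly_Mapping.keys c. Poly_Mapping.lookup c x * f x)"

lemma int_extend_eq_lookup:
  "int_extend f c = Poly_Mapping.lookup (frag_extend (\<lambda>x. frag_cmul (f x) (frag_of ())) c) ()"
  by (simp add: int_extend_def frag_extend_def lookup_sum)

lemma int_extend_diff: "int_extend f (a - b) = int_extend f a - int_extend f b"
  by (simp add: int_extend_eq_lookup frag_extend_diff lookup_minus)

lemma int_extend_add: "int_extend f (a + b) = int_extend f a + int_extend f b"
  by (simp add: int_extend_eq_lookup frag_extend_add lookup_add)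

lemma int_extend_cmul: "int_extend f (frag_cmul k a) = k * int_extend f a"
  by (simp add: int_extend_eq_lookup frag_extend_cmul)

lemma int_extend_0 [simp]: "int_extend f 0 = 0"
  by (simp add: int_extend_def)

lemma int_extend_of [simp]: "int_extend f (frag_of x) = f x"
  by (simp add: int_extend_eq_lookup)

lemma int_extend_sum: "int_extend f (sum c I) = (\<Sum>i\<in>I. int_extend f (c i))"
  by (induction I rule: infinite_finite_induct) (simp_all add: int_extend_add)

text \<open>A Mochizuki-type 3-cocycle. For representatives \<open>y, z\<close> in \<open>{0..<m}\<close> the carry
  \<open>((2 * z - y) mod m + y - 2 * z) div m\<close> equals \<open>- ((2 * z - y) div m)\<close>.\<close>

fun mochizuki :: "nat \<Rightarrow> int list \<Rightarrow> int" where
  "mochizuki m [x, y, z] = (y - x) * ((2 * z - y) div int m)"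
| "mochizuki m _ = 0"

context
  fixes m :: nat
  assumes odd_m: "odd m"
begin

interpretation quandle "dihedral_carrier m" "dihedral_op m"
  using odd_m by (intro dihedral_quandle) (cases m; simp)

lemma m_pos: "m > 0"
  using odd_m by (cases m) auto

lemma dihedral_carrier_iff: "x \<in> dihedral_carrier m \<longleftrightarrow> 0 \<le> x \<and> x < int m"
  using m_pos by (simp add: dihedral_carrier_def carrier_integer_mod_group)

lemma mod_in_dihedral_carrier: "x mod int m \<in> dihedral_carrier m"
  using m_pos by (simp add: dihedral_carrier_iff)

lemma dihedral_op_mod: "dihedral_op m (x mod int m) (y mod int m) = (2 * y - x) mod int m"
  unfolding dihedral_op_def by (intro mod_diff_cong mod_mult_cong) simp_all

text \<open>Modulo \<open>m\<close> the value on the boundary of \<open>(a, b, c, d)\<close> is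
  \<open>(b - a) * K\<close>, where \<open>K\<close> combines carries of \<open>b\<close>,
  \<open>c\<close>, \<open>d\<close>. Self-distributivity for \<open>b\<close>, \<open>c\<close>,
  \<open>d\<close>, written out over the integers, says \<open>int m * K = 0\<close>.\<close>

lemma mochizuki_boundary:
  assumes "Poly_Mapping.keys d \<subseteq> tuples (dihedral_carrier m) 4"
  shows "int m dvd int_extend (mochizuki m) (rack_boundary (dihedral_op m) d)"
  using assms
proof (induction d rule: frag_induction)
  case zero
  then show ?case by (simp add: rack_boundary_def)
next
  case (one xs)
  then obtain a b c d where xs: "xs = [a, b, c, d]"
    and mem: "a \<in> dihedral_carrier m" "b \<in> dihedral_carrier m" "c \<in> dihedral_carrier m"
      "d \<in> dihedral_carrier m"
    by (auto simp: tuples_4)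
  define F where "F y z = (2 * z - y) div int m" for y z
  have op: "dihedral_op m y z = 2 * z - y - int m * F y z" for y z
    by (simp add: dihedral_op_def F_def minus_div_mult_eq_mod[symmetric] mult.commute)
  let ?op = "dihedral_op m"
  define K where "K = - 2 * F c d + F (?op b c) d + F b d - F (?op b d) (?op c d) - F b c"
  have mF: "int m * F y z = 2 * z - y - ?op y z" for y z
    by (simp add: op)
  have "int m * K = - 2 * (int m * F c d) + int m * F (?op b c) d + int m * F b d
      - int m * F (?op b d) (?op c d) - int m * F b c"
    by (simp add: K_def algebra_simps)
  also have "\<dots> = 0"
    unfolding mF using self_distrib[OF mem(2-4)] by simp
  finally have K: "K = 0" using m_pos by simp
  have "int_extend (mochizuki m) (tuple_boundary ?op xs)
      = (c - ?op a b) * F c d - (c - a) * F c d - ((?op b c - ?op a c) * F (?op b c) d - (b - a) * F b d)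
        + ((?op b d - ?op a d) * F (?op b d) (?op c d) - (b - a) * F b c)"
    unfolding xs tuple_boundary_4 int_extend_add int_extend_diff by (simp add: F_def)
  also have "\<dots> = int m * (F a b * F c d + (F b c - F a c) * F (?op b c) d
      - (F b d - F a d) * F (?op b d) (?op c d)) - (a - b) * K"
    by (simp add: op K_def algebra_simps)
  finally show ?case by (simp add: K)
next
  case (diff a b)
  then show ?case by (simp add: rack_boundary_diff int_extend_diff)
qed

lemma mochizuki_degenerate:
  assumes "Poly_Mapping.keys c \<subseteq> degenerate_tuples (dihedral_carrier m) 3"
  shows "int_extend (mochizuki m) c = 0"
  using assms
proof (induction c rule: frag_induction)
  case (one xs)
  then obtain x y z where xs: "xs = [x, y, z]" by (auto simp: degenerate_tuples_def tuples_3)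
  then have "0 \<le> z" "z < int m" "x = y \<or> y = z"
    using one by (auto simp: degenerate_3 dihedral_carrier_iff)
  then show ?case by (auto simp: xs)
qed (simp_all add: int_extend_diff)

text \<open>The shadow coloured diagram of the torus link \<open>T(2, m)\<close>.\<close>

definition torus_cycle :: "int list \<Rightarrow>\<^sub>0 int" where
  "torus_cycle = (\<Sum>i<m. frag_of [0, int i, (int i + 1) mod int m])"

lemma keys_torus_cycle: "Poly_Mapping.keys torus_cycle \<subseteq> tuples (dihedral_carrier m) 3"
proof -
  have "Poly_Mapping.keys torus_cycle
      \<subseteq> (\<Union>i<m. Poly_Mapping.keys (frag_of [0, int i, (int i + 1) mod int m]))"
    unfolding torus_cycle_def by (rule keys_sum)
  also have "\<dots> \<subseteq> tuples (dihedral_carrier m) 3"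
    using m_pos by (auto simp: tuples_3 mod_in_dihedral_carrier dihedral_carrier_iff)
  finally show ?thesis .
qed

lemma boundary_torus_cycle: "rack_boundary (dihedral_op m) torus_cycle = 0"
proof -
  \<comment> \<open>Chosen so that the boundary of the \<open>i\<close>-th summand is
    \<open>a i - a (Suc i)\<close>; the sum telescopes to zero since
    \<open>a m = a 0\<close>.\<close>
  define a where "a i = frag_of [(2 * int i) mod int m, (int i + 1) mod int m]
      + frag_of [0, int i mod int m]" for i
  have "rack_boundary (dihedral_op m) torus_cycle
      = (\<Sum>i<m. tuple_boundary (dihedral_op m) [0, int i, (int i + 1) mod int m])"
    unfolding torus_cycle_def rack_boundary_def by (simp add: frag_extend_sum)
  also have "\<dots> = (\<Sum>i<m. a i - a (Suc i))"
  proof (rule sum.cong)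
    fix i assume "i \<in> {..<m}"
    then have "int i mod int m = int i" by simp
    moreover have "(2 * ((int i + 1) mod int m)) mod int m = (2 * (int i + 1)) mod int m"
      "(2 * ((int i + 1) mod int m) - int i) mod int m = (2 * (int i + 1) - int i) mod int m"
      by (simp_all only: mod_mult_right_eq mod_diff_left_eq[symmetric, of "2 * _"])
    ultimately show "tuple_boundary (dihedral_op m) [0, int i, (int i + 1) mod int m] = a i - a (Suc i)"
      by (simp add: tuple_boundary_3 dihedral_op_def a_def algebra_simps)
  qed simp
  also have "\<dots> = a 0 - a m" by (rule sum_lessThan_telescope')
  also have "\<dots> = 0" by (simp add: a_def mod_add_self1)
  finally show ?thesis .
qed

text \<open>For \<open>m > 1\<close> only the last two summands contribute: \<open>i = m - 2\<close>
  gives \<open>m - 2\<close>, and \<open>i = m - 1\<close>, whose third entry wraps to 0, gives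
  \<open>- (m - 1)\<close>.\<close>

lemma mochizuki_torus_cycle: "int m dvd int_extend (mochizuki m) torus_cycle + 1"
proof (cases "m = 1")
  case False
  then obtain k where m: "m = Suc (Suc k)"
    using m_pos by (intro that[of "m - 2"]) simp
  let ?f = "\<lambda>i. mochizuki m [0, int i, (int i + 1) mod int m]"
  have "?f i = 0" if "i < k" for i
  proof -
    have "(int i + 1) mod int m = int i + 1" using that m by simp
    moreover have "(2 * (int i + 1) - int i) div int m = 0" using that m by simp
    ultimately show ?thesis by simp
  qed
  moreover have "?f k = int k"
  proof -
    have "(int k + 1) mod int m = int k + 1" using m by simp
    moreover have "2 * (int k + 1) - int k = int m" using m by simp
    ultimately show ?thesis using m_pos by simp
  qed
  moreover have "?f (Suc k) = - (int k + 1)"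
  proof -
    have "int (Suc k) + 1 = int m" using m by simp
    moreover have "- int (Suc k) div int m = - 1"
      using m by (intro int_div_pos_eq[where r = 1]) auto
    ultimately show ?thesis by simp
  qed
  ultimately have "int_extend (mochizuki m) torus_cycle = - 1"
    unfolding torus_cycle_def int_extend_sum by (simp add: m)
  then show ?thesis by simp
qed simp

section \<open>Null-homologous chains and the tautological cocycle\<close>

definition null_chains :: "(int list \<Rightarrow>\<^sub>0 int) set" where
  "null_chains = {c. \<exists>d. Poly_Mapping.keys d \<subseteq> tuples (dihedral_carrier m) 4 \<and>
     Poly_Mapping.keys (c - rack_boundary (dihedral_op m) d) \<subseteq> degenerate_tuples (dihedral_carrier m) 3}"

lemma null_chains_0: "0 \<in> null_chains"
  unfolding null_chains_def by (auto intro!: exI[of _ 0] simp: rack_boundary_def)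

lemma null_chains_diff:
  assumes "a \<in> null_chains" "b \<in> null_chains"
  shows "a - b \<in> null_chains"
proof -
  let ?X = "dihedral_carrier m" and ?bd = "rack_boundary (dihedral_op m)"
  obtain d e where
    d: "Poly_Mapping.keys d \<subseteq> tuples ?X 4"
      "Poly_Mapping.keys (a - ?bd d) \<subseteq> degenerate_tuples ?X 3" and
    e: "Poly_Mapping.keys e \<subseteq> tuples ?X 4"
      "Poly_Mapping.keys (b - ?bd e) \<subseteq> degenerate_tuples ?X 3"
    using assms unfolding null_chains_def by blast
  have "a - b - ?bd (d - e) = (a - ?bd d) - (b - ?bd e)"
    by (simp add: rack_boundary_diff)
  then have "Poly_Mapping.keys (a - b - ?bd (d - e)) \<subseteq> degenerate_tuples ?X 3"
    using keys_diff_subset[OF d(2) e(2)] by metis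
  then show ?thesis
    using keys_diff_subset[OF d(1) e(1)] unfolding null_chains_def by blast
qed

interpretation null: dihedral_coefficients m null_chains
  by unfold_locales (fact odd_m null_chains_0 null_chains_diff)+

lemma null_chains_degenerate:
  "Poly_Mapping.keys c \<subseteq> degenerate_tuples (dihedral_carrier m) 3 \<Longrightarrow> c \<in> null_chains"
  unfolding null_chains_def by (auto intro!: exI[of _ 0] simp: rack_boundary_def)

lemma null_chains_boundary:
  "Poly_Mapping.keys d \<subseteq> tuples (dihedral_carrier m) 4 \<Longrightarrow>
    rack_boundary (dihedral_op m) d \<in> null_chains"
  unfolding null_chains_def by auto

lemma null_chains_cmul: "c \<in> null_chains \<Longrightarrow> frag_cmul k c \<in> null_chains"
  by (rule frag_closure_minus_cmul[where P = "\<lambda>c. c \<in> null_chains"])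
    (auto intro: null_chains_0 null_chains_diff)

lemma mochizuki_null:
  assumes "c \<in> null_chains"
  shows "int m dvd int_extend (mochizuki m) c"
proof -
  obtain d where d: "Poly_Mapping.keys d \<subseteq> tuples (dihedral_carrier m) 4"
    "Poly_Mapping.keys (c - rack_boundary (dihedral_op m) d) \<subseteq> degenerate_tuples (dihedral_carrier m) 3"
    using assms unfolding null_chains_def by blast
  have "int_extend (mochizuki m) c = int_extend (mochizuki m) (rack_boundary (dihedral_op m) d)"
    using mochizuki_degenerate[OF d(2)] by (simp add: int_extend_diff)
  then show ?thesis using mochizuki_boundary[OF d(1)] by simp
qed

text \<open>The edge from \<open>p\<close> to \<open>q\<close> is the 2-tuple \<open>(p, y)\<close> with \<open>p * y = q\<close>.\<close>

definition universal :: "int \<Rightarrow> int \<Rightarrow> int \<Rightarrow> int list \<Rightarrow>\<^sub>0 int" where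
  "universal z p q = frag_of [p mod int m, (null.half * (p + q)) mod int m, z mod int m]"

lemma half_double: "(null.half * (2 * x)) mod int m = x mod int m"
  using null.two_half_mult[of x] by (simp add: mult.left_commute)

text \<open>The cocycle expression is minus the boundary of the 4-tuple \<open>?t\<close>, hence
  null.\<close>

lemma cocycle_universal: "null.cocycle universal"
  unfolding null.cocycle_def
proof (intro conjI allI)
  fix z y p q
  show "universal (z mod int m) (p mod int m) (q mod int m) = universal z p q"
  proof -
    have "(null.half * (p mod int m + q mod int m)) mod int m = (null.half * (p + q)) mod int m"
      by (intro mod_mult_cong mod_add_cong) simp_all
    then show ?thesis by (simp add: universal_def)
  qed
  show "universal z p p \<in> null_chains"
    using half_double[of p] unfolding mult_2
    by (intro null_chains_degenerate) (simp add: universal_def degenerate_3 mod_in_dihedral_carrier)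
  show "universal z p (2 * z - p) \<in> null_chains"
    using half_double[of z]
    by (intro null_chains_degenerate) (simp add: universal_def degenerate_3 mod_in_dihedral_carrier)
  show "universal y p q - universal (2 * z - y) (2 * z - p) (2 * z - q) - null.cob (universal z) y p q
      \<in> null_chains"
  proof -
    let ?h = "null.half"
    let ?t = "[p mod int m, (?h * (p + q)) mod int m, y mod int m, z mod int m]"
    have "rack_boundary (dihedral_op m) (frag_of ?t) \<in> null_chains"
      by (intro null_chains_boundary) (auto simp: tuples_4 mod_in_dihedral_carrier)
    moreover have "rack_boundary (dihedral_op m) (frag_of ?t)
        = - (universal y p q - universal (2 * z - y) (2 * z - p) (2 * z - q) - null.cob (universal z) y p q)"
    proof -
      have "(2 * (?h * (p + q)) - p) mod int m = q mod int m"
        unfolding null.two_half_mult by simp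
      moreover have "(?h * (q + (2 * y - q))) mod int m = y mod int m"
        "(?h * (p + (2 * y - p))) mod int m = y mod int m"
        using half_double[of y] by simp_all
      moreover have "(?h * (2 * w - p + (2 * w - q))) mod int m = (2 * w - ?h * (p + q)) mod int m" for w
      proof -
        have "?h * (2 * w - p + (2 * w - q)) = 2 * (?h * (2 * w)) - ?h * (p + q)"
          by (simp add: algebra_simps)
        then show ?thesis unfolding null.two_half_mult by (simp add: mod_eq_dvd_iff)
      qed
      ultimately show ?thesis
        by (simp add: tuple_boundary_4 dihedral_op_mod universal_def null.cob_def)
    qed
    ultimately show ?thesis using null.B_uminus by fastforce
  qed
qed

definition generator :: "int list \<Rightarrow>\<^sub>0 int" where
  "generator = null.invariant universal"

lemma generator_torsion: "int m dvd k \<Longrightarrow> frag_cmul k generator \<in> null_chains"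
proof (elim dvdE)
  fix l assume k: "k = int m * l"
  have "(\<Sum>i<n. generator) = frag_cmul (int n) generator" for n
    by (induction n) (simp_all add: frag_cmul_distrib)
  then have "frag_cmul (int m) generator \<in> null_chains"
    using null.invariant_torsion[OF cocycle_universal] by (simp add: generator_def)
  then have "frag_cmul l (frag_cmul (int m) generator) \<in> null_chains"
    by (rule null_chains_cmul)
  then show ?thesis by (simp add: k mult.commute)
qed

text \<open>Modulo null chains and multiples of \<open>generator\<close>, the invariant of
  \<open>universal\<close> vanishes, so \<open>universal\<close> is a coboundary
  \<open>cob g\<close>. As \<open>universal\<close> sends each triple to itself, \<open>c\<close> is
  congruent to the linear extension of \<open>g\<close> applied to the boundary of \<open>c\<close>.
  For a relative cycle this boundary is degenerate, where \<open>g\<close> vanishes.\<close>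

lemma cycle_multiple_of_generator:
  assumes c: "Poly_Mapping.keys c \<subseteq> tuples (dihedral_carrier m) 3"
    and cycle: "Poly_Mapping.keys (rack_boundary (dihedral_op m) c)
      \<subseteq> degenerate_tuples (dihedral_carrier m) 2"
  obtains k where "c - frag_cmul k generator \<in> null_chains"
proof -
  define B where "B = {c. \<exists>k. c - frag_cmul k generator \<in> null_chains}"
  have null_B: "a \<in> B" if "a \<in> null_chains" for a
    unfolding B_def using that by (auto intro!: exI[of _ 0])
  interpret B: dihedral_coefficients m B
  proof
    fix a b assume "a \<in> B" "b \<in> B"
    then obtain k l where "a - frag_cmul k generator \<in> null_chains" "b - frag_cmul l generator \<in> null_chains"
      by (auto simp: B_def)
    from null_chains_diff[OF this] have "a - b - frag_cmul (k - l) generator \<in> null_chains"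
      by (simp add: frag_cmul_diff_distrib algebra_simps)
    then show "a - b \<in> B" unfolding B_def by blast
  qed (simp_all add: odd_m null_B null_chains_0)
  have "B.cocycle universal"
    using cocycle_universal null_B unfolding null.cocycle_def B.cocycle_def by blast
  moreover have "B.invariant universal \<in> B"
    unfolding B_def generator_def using null_chains_0 by (auto intro!: exI[of _ 1])
  ultimately obtain g where g: "B.cochain g"
    and cob: "\<And>z p q. universal z p q - B.cob g z p q \<in> B"
    by (rule B.cocycle_coboundary) blast
  \<comment> \<open>\<open>g\<close> read on 2-tuples: \<open>(x, y)\<close> is the edge from
    \<open>x\<close> to \<open>x * y = 2 * y - x\<close>.\<close>
  define G where "G xs = g (xs ! 0) (2 * xs ! 1 - xs ! 0)" for xs
  have per: "B.periodic g" and diag: "\<And>p. g p p \<in> B"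
    using g by (auto simp: B.cochain_def)
  have "c - frag_extend G (rack_boundary (dihedral_op m) c) \<in> B"
    using c
  proof (induction c rule: frag_induction)
    case zero
    then show ?case by (simp add: rack_boundary_def B.B_0)
  next
    case (one xs)
    then obtain x y z where xs: "xs = [x, y, z]"
      and mem: "x \<in> dihedral_carrier m" "y \<in> dihedral_carrier m" "z \<in> dihedral_carrier m"
      by (auto simp: tuples_3)
    have "frag_of xs = universal z x (2 * y - x)"
      using mem half_double[of y] by (simp add: xs universal_def dihedral_carrier_iff)
    moreover have "frag_extend G (tuple_boundary (dihedral_op m) xs) = B.cob g z x (2 * y - x)"
    proof -
      have op_mod: "dihedral_op m a b mod int m = (2 * b - a) mod int m" for a b
        by (simp add: dihedral_op_def)
      have "(2 * dihedral_op m y z - dihedral_op m x z) mod int m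
          = (2 * (2 * z - y) - (2 * z - x)) mod int m"
        by (intro mod_diff_cong mod_mult_cong op_mod refl)
      also have "2 * (2 * z - y) - (2 * z - x) = 2 * z - (2 * y - x)" by simp
      finally have "G [dihedral_op m x z, dihedral_op m y z] = g (2 * z - x) (2 * z - (2 * y - x))"
        by (simp add: G_def) (intro B.periodicD[OF per] op_mod)
      moreover have "G [dihedral_op m x y, z] = g (2 * y - x) (2 * z - (2 * y - x))"
        by (simp add: G_def) (intro B.periodicD[OF per] op_mod mod_diff_cong refl)
      ultimately show ?thesis
        by (simp add: xs tuple_boundary_3 frag_extend_diff frag_extend_add B.cob_def G_def)
    qed
    ultimately show ?case using cob[of z x "2 * y - x"] unfolding rack_boundary_of by simp
  next
    case (diff a b)
    then show ?case
      using B.B_diff[OF diff] by (simp add: rack_boundary_diff frag_extend_diff algebra_simps)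
  qed
  moreover have "frag_extend G e \<in> B"
    if "Poly_Mapping.keys e \<subseteq> degenerate_tuples (dihedral_carrier m) 2" for e
    using that
  proof (induction e rule: frag_induction)
    case (one xs)
    then obtain x y where xs: "xs = [x, y]" by (auto simp: degenerate_tuples_def tuples_2)
    then show ?case using one diag[of x] by (simp add: degenerate_2 G_def)
  qed (simp_all add: B.B_0 B.B_diff frag_extend_diff)
  ultimately have "c - frag_extend G (rack_boundary (dihedral_op m) c)
      + frag_extend G (rack_boundary (dihedral_op m) c) \<in> B"
    using B.B_add cycle by blast
  then have "c \<in> B" by simp
  then show ?thesis using that by (auto simp: B_def)
qed

text \<open>Both \<open>c\<close> and \<open>torus_cycle\<close> are multiples of
  \<open>generator\<close> up to null chains. The value -1 on \<open>torus_cycle\<close> makes the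
  value on \<open>generator\<close> a unit modulo \<open>m\<close>, so the coefficient
  \<open>k\<close> of \<open>c\<close> is divisible by \<open>m\<close>, and \<open>m\<close> times
  \<open>generator\<close> is null.\<close>

lemma null_if_mochizuki:
  assumes c: "Poly_Mapping.keys c \<subseteq> tuples (dihedral_carrier m) 3"
    and cycle: "Poly_Mapping.keys (rack_boundary (dihedral_op m) c)
      \<subseteq> degenerate_tuples (dihedral_carrier m) 2"
    and dvd: "int m dvd int_extend (mochizuki m) c"
  shows "c \<in> null_chains"
proof -
  let ?\<phi> = "int_extend (mochizuki m)"
  obtain k where k: "c - frag_cmul k generator \<in> null_chains"
    using cycle_multiple_of_generator[OF c cycle] .
  obtain l where l: "torus_cycle - frag_cmul l generator \<in> null_chains"
    using cycle_multiple_of_generator[OF keys_torus_cycle] by (auto simp: boundary_torus_cycle)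
  have d1: "int m dvd ?\<phi> torus_cycle - l * ?\<phi> generator"
    using mochizuki_null[OF l] by (simp add: int_extend_diff int_extend_cmul)
  have d2: "int m dvd ?\<phi> torus_cycle + 1"
    by (rule mochizuki_torus_cycle)
  have d3: "int m dvd k * ?\<phi> generator"
    using mochizuki_null[OF k] dvd by (simp add: int_extend_diff int_extend_cmul dvd_diff_right_iff)
  \<comment> \<open>This combination is equal to \<open>k\<close>.\<close>
  have "int m dvd k * (?\<phi> torus_cycle + 1) - k * (?\<phi> torus_cycle - l * ?\<phi> generator)
      - l * (k * ?\<phi> generator)"
    by (rule dvd_diff[OF dvd_diff[OF dvd_mult[OF d2] dvd_mult[OF d1]] dvd_mult[OF d3]])
  then have "int m dvd k" by (simp add: algebra_simps)
  then show ?thesis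
    using null.B_add[OF k generator_torsion[of k]] by simp
qed

lemma quandle_homology_dihedral:
  "quandle_homology (dihedral_carrier m) (dihedral_op m) 3 \<cong> integer_mod_group m"
proof -
  let ?X = "dihedral_carrier m" and ?op = "dihedral_op m" and ?\<phi> = "int_extend (mochizuki m)"
  have "quandle_homology ?X ?op (Suc 2) \<cong> integer_mod_group m"
  proof (rule quandle_homology_iso[where \<phi> = "\<lambda>c. ?\<phi> c mod int m"], unfold Suc_numeral semiring_norm)
    show "(\<lambda>c. ?\<phi> c mod int m) \<in> hom (rack_chain_group ?X 3) (integer_mod_group m)"
      using m_pos by (intro homI) (simp_all add: carrier_integer_mod_group rack_chain_group_def
          int_extend_add mod_simps)
    show "\<exists>c. Poly_Mapping.keys c \<subseteq> tuples ?X 3 \<and>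
        Poly_Mapping.keys (rack_boundary ?op c) \<subseteq> degenerate_tuples ?X 2 \<and> ?\<phi> c mod int m = y"
      if "y \<in> carrier (integer_mod_group m)" for y
    proof (intro exI conjI)
      \<comment> \<open>The sign compensates for the value -1 on \<open>torus_cycle\<close>.\<close>
      let ?c = "frag_cmul (- y) torus_cycle"
      show "Poly_Mapping.keys ?c \<subseteq> tuples ?X 3"
        using keys_torus_cycle keys_cmul[of "- y" torus_cycle] by blast
      show "Poly_Mapping.keys (rack_boundary ?op ?c) \<subseteq> degenerate_tuples ?X 2"
        using boundary_torus_cycle by (simp add: rack_boundary_def frag_extend_cmul)
      have "int m dvd - y * (?\<phi> torus_cycle + 1)"
        by (intro dvd_mult mochizuki_torus_cycle)
      moreover have "- y * (?\<phi> torus_cycle + 1) = ?\<phi> ?c - y"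
        by (simp add: int_extend_cmul algebra_simps)
      ultimately have "?\<phi> ?c mod int m = y mod int m"
        by (simp only: mod_eq_dvd_iff)
      then show "?\<phi> ?c mod int m = y"
        using that m_pos by (simp add: carrier_integer_mod_group)
    qed
    show "?\<phi> c mod int m = \<one>\<^bsub>integer_mod_group m\<^esub> \<longleftrightarrow>
        (\<exists>d. Poly_Mapping.keys d \<subseteq> tuples ?X 4 \<and>
          Poly_Mapping.keys (c - rack_boundary ?op d) \<subseteq> degenerate_tuples ?X 3)"
      if "Poly_Mapping.keys c \<subseteq> tuples ?X 3"
        "Poly_Mapping.keys (rack_boundary ?op c) \<subseteq> degenerate_tuples ?X 2" for c
    proof -
      have "?\<phi> c mod int m = \<one>\<^bsub>integer_mod_group m\<^esub> \<longleftrightarrow> c \<in> null_chains"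
        using null_if_mochizuki[OF that] mochizuki_null[of c] by (auto simp: mod_eq_0_iff_dvd)
      then show ?thesis by (simp add: null_chains_def)
    qed
  qed (simp_all add: boundary_tuples_3 boundary_tuples_4 boundary_degenerate_3 boundary_degenerate_4
      boundary_boundary_4)
  then show ?thesis by simp
qed

end

theorem corollary3p11:
  fixes m :: nat
  assumes "odd m" and "m > 0"
  shows "quandle_homology (dihedral_carrier m) (dihedral_op m) 3 \<cong> integer_mod_group m"
  using assms(1) by (rule quandle_homology_dihedral)

end
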